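(* Let $(f_t)_{t\in[0,1]}$ be an isotopy in $\mathrm{Diff}^1(\mathbb{T}^2)$ joining the identity $\mathrm{Id}_{\mathbb{T}^2}$ to $f_1=f$. Then there exists an $f$-invariant Borel probability measure $\mu$ on $\mathbb{T}^2$ of null torsion, i.e. $\mathrm{Torsion}((f_t)_t,\mu)=0$.
   Context: $\mathbb{T}=\mathbb{R}/2\pi\mathbb{Z}$, $\mathbb{T}^2=\mathbb{R}^2/(2\pi\mathbb{Z})^2$, with the flat metric, the standard trivialization of the tangent bundle and the counterclockwise orientation. An isotopy joining the identity to $f$ is a path $(f_t)_{t\in[0,1]}$ in $\mathrm{Diff}^1(\mathbb{T}^2)$, continuous for the compact-open $C^1$ topology, with $f_0=\mathrm{Id}$ and $f_1=f$; it is extended to $t\ge0$ by $f_t=f_{\{t\}}\circ f^{\lfloor t\rfloor}$ ($\{t\}$ fractional part, $\lfloor t\rfloor$ integer part). $\theta(u,v)\in\mathbb{T}$ is the oriented angle from $u$ to $v$. For $z\in\mathbb{T}^2$, $\xi\in T_z\mathbb{T}^2\setminus\{0\}$ and $n\ge1$: $\mathrm{Torsion}_n((f_t)_t,z,\xi)=\frac1n(\tilde v(n)-\tilde v(0))$, where $\tilde v$ is any continuous lift to $\mathbb{R}$ of $t\mapsto\theta((1,0),Df_t(z)\xi)$, $t\ge0$. If it converges as $n\to+\infty$ for some $\xi\neq0$, the limit is denoted $\mathrm{Torsion}((f_t)_t,z)$ (existence and value do not depend on $\xi$). For an $f$-invariant Borel probability measure $\mu$ on $\mathbb{T}^2$,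 $\mathrm{Torsion}((f_t)_t,\cdot)$ is defined $\mu$-almost everywhere and integrable, and $\mathrm{Torsion}((f_t)_t,\mu)=\int_{\mathbb{T}^2}\mathrm{Torsion}((f_t)_t,z)\,d\mu(z)$. *)

theory Defs
  imports "HOL-Probability.Probability"
begin

definition circle_rel :: "real \<Rightarrow> real \<Rightarrow> bool" where
  "circle_rel x y \<longleftrightarrow> (\<exists>k::int. x - y = 2 * pi * of_int k)"

lemma equivp_circle_rel: "equivp circle_rel"
proof (rule equivpI)
  show "reflp circle_rel"
    by (auto simp: reflp_def circle_rel_def intro: exI[of _ 0])
  show "symp circle_rel"
  proof (rule sympI)
    fix x y assume "circle_rel x y"
    then obtain k :: int where "x - y = 2 * pi * of_int k"
      by (auto simp: circle_rel_def)
    then have "y - x = 2 * pi * of_int (- k)" by simp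
    then show "circle_rel y x" unfolding circle_rel_def by blast
  qed
  show "transp circle_rel"
  proof (rule transpI)
    fix x y z assume "circle_rel x y" "circle_rel y z"
    then obtain k l :: int where "x - y = 2 * pi * of_int k" "y - z = 2 * pi * of_int l"
      by (auto simp: circle_rel_def)
    then have "x - z = 2 * pi * of_int (k + l)" by (simp add: algebra_simps)
    then show "circle_rel x z" unfolding circle_rel_def by blast
  qed
qed

quotient_type circle = real / circle_rel
  by (rule equivp_circle_rel)

instantiation circle :: topological_space
begin

definition open_circle :: "circle set \<Rightarrow> bool" where
  "open_circle U \<longleftrightarrow> open (abs_circle -` U)"

instance
proof
  show "open (UNIV :: circle set)" by (simp add: open_circle_def)
  show "open (S \<inter> T)" if "open S" "open T" for S T :: "circle set"
    using that by (simp add: open_circle_def vimage_Int open_Int)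
  show "open (\<Union> K)" if "\<forall>S\<in>K. open S" for K :: "circle set set"
    using that by (auto simp: open_circle_def vimage_Union)
qed

end

type_synonym torus = "circle \<times> circle"

definition torus_proj :: "real \<times> real \<Rightarrow> torus" where
  "torus_proj = map_prod abs_circle abs_circle"

text \<open>
  The tangent bundle of the torus is trivialised by \<open>torus_proj\<close>. The map \<open>F\<close> below is \<open>f\<close> read
  in the local charts inverse to \<open>torus_proj\<close>: being differentiable, hence continuous, at \<open>a\<close>, it
  stays in a single chart near \<open>a\<close>, and its derivative depends neither on \<open>a\<close> nor on \<open>F\<close>.
\<close>

definition has_torus_derivative ::
    "(torus \<Rightarrow> torus) \<Rightarrow> ((real \<times> real) \<Rightarrow>\<^sub>L (real \<times> real)) \<Rightarrow> torus \<Rightarrow> bool" where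
  "has_torus_derivative f A z \<longleftrightarrow>
     (\<exists>a F. torus_proj a = z \<and>
        (\<forall>\<^sub>F x in nhds a. torus_proj (F x) = f (torus_proj x)) \<and>
        (F has_derivative blinfun_apply A) (at a))"

definition torus_deriv :: "(torus \<Rightarrow> torus) \<Rightarrow> torus \<Rightarrow> (real \<times> real) \<Rightarrow>\<^sub>L (real \<times> real)" where
  "torus_deriv f z = (THE A. has_torus_derivative f A z)"

definition C1_torus_map :: "(torus \<Rightarrow> torus) \<Rightarrow> bool" where
  "C1_torus_map f \<longleftrightarrow>
     (\<forall>z. \<exists>A. has_torus_derivative f A z) \<and> continuous_on UNIV (torus_deriv f)"

definition Diff1_torus :: "(torus \<Rightarrow> torus) set" where
  "Diff1_torus = {f. bij f \<and> C1_torus_map f \<and> C1_torus_map (inv f)}"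

definition compact_open_topology ::
    "('a::topological_space \<Rightarrow> 'b::topological_space) topology" where
  "compact_open_topology =
     topology_generated_by
       {{g. continuous_on UNIV g \<and> g ` K \<subseteq> U} | K U. compact K \<and> open U}"

definition tangent_map :: "(torus \<Rightarrow> torus) \<Rightarrow> torus \<times> (real \<times> real) \<Rightarrow> torus \<times> (real \<times> real)" where
  "tangent_map f = (\<lambda>(z, \<xi>). (f z, blinfun_apply (torus_deriv f z) \<xi>))"

text \<open>
  The compact-open \<open>C\<^sup>1\<close> topology is the one induced by the compact-open topology on maps of the
  tangent bundle; as closed balls of the fibres are compact, it controls \<open>f\<close> and its
  derivative uniformly.
\<close>

definition Diff1_topology :: "(torus \<Rightarrow> torus) topology" where
  "Diff1_topology = pullback_topology Diff1_torus tangent_map compact_open_topology"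

definition isotopy_from_id :: "(real \<Rightarrow> torus \<Rightarrow> torus) \<Rightarrow> (torus \<Rightarrow> torus) \<Rightarrow> bool" where
  "isotopy_from_id F f \<longleftrightarrow>
     continuous_map (top_of_set {0..1}) Diff1_topology F \<and> F 0 = id \<and> F 1 = f"

definition extended_isotopy :: "(real \<Rightarrow> torus \<Rightarrow> torus) \<Rightarrow> real \<Rightarrow> torus \<Rightarrow> torus" where
  "extended_isotopy F t = F (frac t) \<circ> (F 1 ^^ nat \<lfloor>t\<rfloor>)"

definition rotation :: "real \<Rightarrow> real \<times> real \<Rightarrow> real \<times> real" where
  "rotation r = (\<lambda>(x, y). (cos r * x - sin r * y, sin r * x + cos r * y))"

definition oriented_angle :: "real \<times> real \<Rightarrow> real \<times> real \<Rightarrow> circle" where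
  "oriented_angle u v = (THE \<alpha>. \<exists>r. \<alpha> = abs_circle r \<and> sgn v = rotation r (sgn u))"

definition is_angle_lift ::
    "(real \<Rightarrow> torus \<Rightarrow> torus) \<Rightarrow> torus \<Rightarrow> real \<times> real \<Rightarrow> (real \<Rightarrow> real) \<Rightarrow> bool" where
  "is_angle_lift F z \<xi> v \<longleftrightarrow>
     continuous_on {0..} v \<and>
     (\<forall>t\<ge>0. abs_circle (v t) =
        oriented_angle (1, 0) (blinfun_apply (torus_deriv (extended_isotopy F t) z) \<xi>))"

text \<open>
  Two lifts differ by a constant, so the choice of \<open>v\<close> is immaterial; for an isotopy and
  \<open>\<xi> \<noteq> 0\<close> a lift exists by continuity of \<open>t \<mapsto> f\<^sub>t\<close>.
\<close>

definition torsion_at :: "nat \<Rightarrow> (real \<Rightarrow> torus \<Rightarrow> torus) \<Rightarrow> torus \<Rightarrow> real \<times> real \<Rightarrow> real" where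
  "torsion_at n F z \<xi> =
     (let v = (SOME v. is_angle_lift F z \<xi> v) in (v (real n) - v 0) / real n)"

definition has_torsion :: "(real \<Rightarrow> torus \<Rightarrow> torus) \<Rightarrow> torus \<Rightarrow> real \<Rightarrow> bool" where
  "has_torsion F z \<tau> \<longleftrightarrow> (\<exists>\<xi>. \<xi> \<noteq> 0 \<and> (\<lambda>n. torsion_at n F z \<xi>) \<longlonglongrightarrow> \<tau>)"

text \<open>
  Where the limit does not exist, \<open>torsion F z\<close> is an unspecified constant independent of \<open>z\<close>;
  statements about \<open>measure_torsion F \<mu>\<close> are only meaningful together with almost everywhere
  existence and integrability.
\<close>

definition torsion :: "(real \<Rightarrow> torus \<Rightarrow> torus) \<Rightarrow> torus \<Rightarrow> real" where
  "torsion F z = (THE \<tau>. has_torsion F z \<tau>)"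

definition measure_torsion :: "(real \<Rightarrow> torus \<Rightarrow> torus) \<Rightarrow> torus measure \<Rightarrow> real" where
  "measure_torsion F \<mu> = (\<integral>z. torsion F z \<partial>\<mu>)"

definition invariant_borel_prob :: "(torus \<Rightarrow> torus) \<Rightarrow> torus measure \<Rightarrow> bool" where
  "invariant_borel_prob f \<mu> \<longleftrightarrow>
     prob_space \<mu> \<and> sets \<mu> = sets borel \<and> f \<in> borel_measurable borel \<and> distr \<mu> borel f = \<mu>"

end

theory Submission
  imports Defs
begin

text \<open>
  The derivative of \<open>f\<close> acts on tangent directions as a skew product over \<open>f\<close> on
  \<open>T\<^sup>2 \<times> T\<close>, and the angle variation along the isotopy up to time \<open>n\<close> is the Birkhoff sum of the
  variation up to time \<open>1\<close>. A chord argument in the spirit of Hopf's Umlaufsatz gives, for every \<open>n\<close>,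
  a point where the horizontal direction turns by at most \<open>\<pi>\<close> up to time \<open>n\<close>. A weak limit of the
  empirical measures along these orbit segments is invariant under the skew product and integrates
  the variation up to time \<open>1\<close> to \<open>0\<close>. By Birkhoff's theorem the torsion exists almost everywhere and has
  integral \<open>0\<close> for the projection of this measure to the torus.
\<close>

section \<open>The circle as a metric space\<close>

text \<open>The bound \<pi> helps because it does not grow with \<open>n\<close>: divided by
  \<open>n\<close> it vanishes. The start points of the orbit segments vary with \<open>n\<close>,
  so nothing is obtained about the torsion along any single orbit; only averages survive the weak
  limit, which is why the result is a measure. The product with the circle is forced because the
  angle variation is a function of point and direction together; it is continuous there, so the weak
  limit can be tested on it. Projecting back loses nothing: two directions at one point differ in
  their variation by at most \<pi>, since linear isomorphisms preserve collinearity. That the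
  isotopy starts at the identity shapes the chord argument: the lift to the plane then commutes with
  lattice translations, so the chord over a full period stays horizontal, and it is injective, so no
  chord degenerates. Weak compactness is taken from the line: a space-filling curve carries the
  empirical measures there and their limit back.\<close>

lemma cis_eq_iff_2pi_multiple: "cis x = cis y \<longleftrightarrow> (\<exists>k::int. x - y = 2 * pi * of_int k)"
proof
  assume "cis x = cis y"
  then have "cis (x - y) = 1"
    by (simp flip: cis_divide)
  then have "cos (x - y) = 1"
    by (simp add: complex_eq_iff)
  then show "\<exists>k::int. x - y = 2 * pi * of_int k"
    by (auto simp: cos_one_2pi_int mult_ac)
next
  assume "\<exists>k::int. x - y = 2 * pi * of_int k"
  then obtain k :: int where k: "x = y + 2 * pi * of_int k"
    by (auto simp: algebra_simps)
  show "cis x = cis y"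
    unfolding k by (simp add: cis_mult [symmetric] cis_multiple_2pi)
qed

definition circ :: "circle \<Rightarrow> complex" where
  "circ c = cis (rep_circle c)"

lemma abs_circle_eq_iff: "abs_circle x = abs_circle y \<longleftrightarrow> cis x = cis y"
  unfolding circle.abs_eq_iff circle_rel_def cis_eq_iff_2pi_multiple ..

lemma abs_circle_rep [simp]: "abs_circle (rep_circle c) = c"
  by (rule Quotient_abs_rep [OF Quotient_circle])

lemma circ_abs [simp]: "circ (abs_circle x) = cis x"
  unfolding circ_def using abs_circle_eq_iff [of "rep_circle (abs_circle x)" x] by simp

lemma circ_eq_iff [simp]: "circ c = circ d \<longleftrightarrow> c = d"
  using abs_circle_eq_iff [of "rep_circle c" "rep_circle d"] by (simp add: circ_def)

lemma circle_cases [cases type: circle]: obtains x where "c = abs_circle x"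
  using abs_circle_rep by metis

lemma norm_circ [simp]: "norm (circ c) = 1"
  by (simp add: circ_def)

lemma abs_circle_representative:
  obtains x' where "abs_circle x' = abs_circle x" "\<bar>x' - y\<bar> = \<bar>Arg (cis (x - y))\<bar>"
proof
  have "cis (Arg (cis (x - y))) = cis (x - y)"
    by (metis cis_Arg cis_neq_zero norm_cis sgn_cis)
  then show "abs_circle (y + Arg (cis (x - y))) = abs_circle x"
    by (simp add: abs_circle_eq_iff flip: cis_mult cis_divide)
qed simp

text \<open>The topology is already fixed as the quotient topology, so the chord metric has to be
  matched with it. Short chords give close representatives because \<open>Arg\<close> is continuous
  at 1, to where the rotation by \<open>cis y\<close> moves the comparison.\<close>

lemma open_circle_iff:
  "open S \<longleftrightarrow> (\<forall>c\<in>S. \<exists>e>0. \<forall>d. norm (circ d - circ c) < e \<longrightarrow> d \<in> S)"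
proof
  assume S: "open S"
  show "\<forall>c\<in>S. \<exists>e>0. \<forall>d. norm (circ d - circ c) < e \<longrightarrow> d \<in> S"
  proof
    fix c assume "c \<in> S"
    obtain y where y: "c = abs_circle y" by (cases c)
    have "open (abs_circle -` S)" using S by (simp add: open_circle_def)
    with \<open>c \<in> S\<close> y obtain r where r: "r > 0" "\<And>x. \<bar>x - y\<bar> < r \<Longrightarrow> abs_circle x \<in> S"
      by (auto simp: open_dist dist_real_def)
    have "continuous (at 1) Arg"
      by (rule continuous_at_Arg) simp
    then obtain e where e: "e > 0" "\<And>w. norm (w - 1) < e \<Longrightarrow> \<bar>Arg w\<bar> < r"
      unfolding continuous_at_eps_delta using \<open>r > 0\<close>
      by (auto simp: dist_norm Arg_eq_0)
    have "d \<in> S" if "norm (circ d - circ c) < e" for d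
    proof -
      obtain x where x: "d = abs_circle x" by (cases d)
      have "cis x - cis y = cis y * (cis (x - y) - 1)"
        by (simp add: algebra_simps cis_mult)
      then have "norm (cis (x - y) - 1) < e"
        using that x y by (simp add: norm_mult)
      then have "\<bar>Arg (cis (x - y))\<bar> < r" by (rule e)
      then show "d \<in> S"
        using r(2) x by (metis abs_circle_representative)
    qed
    with \<open>e > 0\<close> show "\<exists>e>0. \<forall>d. norm (circ d - circ c) < e \<longrightarrow> d \<in> S" by blast
  qed
next
  assume *: "\<forall>c\<in>S. \<exists>e>0. \<forall>d. norm (circ d - circ c) < e \<longrightarrow> d \<in> S"
  have "open (abs_circle -` S)"
    unfolding open_dist
  proof
    fix x assume "x \<in> abs_circle -` S"
    with * obtain e where e: "e > 0" "\<And>d. norm (circ d - cis x) < e \<Longrightarrow> d \<in> S"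
      by fastforce
    have "isCont cis x"
      using continuous_on_cis [OF continuous_on_id, of UNIV] by (simp add: continuous_on_eq_continuous_at)
    then obtain r where "r > 0" "\<And>y. dist y x < r \<Longrightarrow> norm (cis y - cis x) < e"
      unfolding continuous_at_eps_delta dist_norm [where 'a = complex] using \<open>e > 0\<close> by metis
    then show "\<exists>r>0. \<forall>y. dist y x < r \<longrightarrow> y \<in> abs_circle -` S"
      using e(2) by (metis circ_abs vimageI2)
  qed
  then show "open S" by (simp add: open_circle_def)
qed

instantiation circle :: metric_space
begin

definition dist_circle :: "circle \<Rightarrow> circle \<Rightarrow> real" where
  "dist_circle c d = norm (circ c - circ d)"

definition uniformity_circle :: "(circle \<times> circle) filter" where
  "uniformity_circle = (INF e\<in>{0<..}. principal {(x, y). dist x y < e})"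

instance
proof
  show "uniformity = (INF e\<in>{0<..}. principal {(x, y :: circle). dist x y < e})"
    by (rule uniformity_circle_def)
  show "open U \<longleftrightarrow> (\<forall>x\<in>U. \<forall>\<^sub>F (x', y) in uniformity. x' = x \<longrightarrow> y \<in> U)" for U :: "circle set"
    unfolding open_circle_iff uniformity_circle_def
    by (subst eventually_INF_base)
       (auto simp: eventually_principal dist_circle_def norm_minus_commute subset_eq
             intro: bexI [of _ "min _ _"])
  show "dist x y = 0 \<longleftrightarrow> x = y" for x y :: circle
    by (simp add: dist_circle_def)
  show "dist x y \<le> dist x z + dist y z" for x y z :: circle
    unfolding dist_circle_def using norm_triangle_ineq4 [of "circ x - circ z" "circ y - circ z"] by simp
qed

end

lemma continuous_on_circ [continuous_intros]:
  "continuous_on S f \<Longrightarrow> continuous_on S (\<lambda>x. circ (f x))"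
proof (rule continuous_on_compose2 [of UNIV circ])
  show "continuous_on UNIV circ"
    by (auto simp: continuous_on_iff dist_circle_def dist_norm)
qed auto

lemma continuous_on_abs_circle [continuous_intros]:
  "continuous_on S f \<Longrightarrow> continuous_on S (\<lambda>x. abs_circle (f x))"
proof (rule continuous_on_compose2 [of UNIV abs_circle])
  show "continuous_on UNIV abs_circle"
    unfolding continuous_on_open_vimage [OF open_UNIV] by (simp add: open_circle_def)
qed auto

lemma open_abs_circle_image: "open S \<Longrightarrow> open (abs_circle ` S)"
proof -
  assume "open S"
  have "abs_circle -` abs_circle ` S = (\<Union>k::int. (\<lambda>x. x + 2 * pi * of_int k) -` S)"
  proof (intro set_eqI iffI)
    fix x assume "x \<in> abs_circle -` abs_circle ` S"
    then obtain y where y: "y \<in> S" "cis y = cis x" by (auto simp: abs_circle_eq_iff)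
    then obtain k :: int where "y = x + 2 * pi * of_int k"
      unfolding cis_eq_iff_2pi_multiple by (auto simp: algebra_simps)
    with y show "x \<in> (\<Union>k::int. (\<lambda>x. x + 2 * pi * of_int k) -` S)" by auto
  next
    fix x assume "x \<in> (\<Union>k::int. (\<lambda>x. x + 2 * pi * of_int k) -` S)"
    then obtain k :: int where k: "x + 2 * pi * of_int k \<in> S" by auto
    have "abs_circle (x + 2 * pi * of_int k) = abs_circle x"
      by (auto simp: abs_circle_eq_iff cis_eq_iff_2pi_multiple)
    with k show "x \<in> abs_circle -` abs_circle ` S" by (metis imageI vimageI2)
  qed
  also have "open \<dots>"
    using \<open>open S\<close> by (intro open_UN ballI open_vimage continuous_intros)
  finally show ?thesis by (simp add: open_circle_def)
qed

text \<open>The factor 2\<pi> is split off so that the parameter runs through [0, 1), the range of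
  coordinates that the space-filling curve attains.\<close>

lemma abs_circle_fundamental_domain:
  obtains x where "0 \<le> x" "x < 1" "c = abs_circle (2 * pi * x)"
proof
  have "cis (Arg2pi (circ c)) = circ c"
    using complex_norm_eq_1_exp [of "circ c"] by (simp add: cis_conv_exp)
  then have "c = abs_circle (Arg2pi (circ c))"
    by (metis circ_abs circ_eq_iff)
  then show "c = abs_circle (2 * pi * (Arg2pi (circ c) / (2 * pi)))" by simp
  show "0 \<le> Arg2pi (circ c) / (2 * pi)" "Arg2pi (circ c) / (2 * pi) < 1"
    using Arg2pi [of "circ c"] by simp_all
qed

text \<open>The circle is a continuous image of a compact interval. The class supplies compact
  closed balls in the tangent bundle, the test sets for the compact-open topology below.\<close>

instance circle :: heine_borel
proof
  fix c :: "nat \<Rightarrow> circle"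
  have "\<forall>n. \<exists>x. x \<in> {0..1} \<and> c n = abs_circle (2 * pi * x)"
    using abs_circle_fundamental_domain by (metis atLeastAtMost_iff less_imp_le)
  then obtain x where x: "\<And>n. x n \<in> {0..1}" "\<And>n. c n = abs_circle (2 * pi * x n)"
    by metis
  obtain l r where lr: "strict_mono r" "(x \<circ> r) \<longlonglongrightarrow> l"
    using x(1) compact_Icc [of 0 "1 :: real"] unfolding compact_def by metis
  have "continuous_on UNIV (\<lambda>x. abs_circle (2 * pi * x))" by (intro continuous_intros)
  then have "isCont (\<lambda>x. abs_circle (2 * pi * x)) l"
    by (simp add: continuous_on_eq_continuous_at)
  from isCont_tendsto_compose [OF this lr(2)] have "(c \<circ> r) \<longlonglongrightarrow> abs_circle (2 * pi * l)"
    by (simp add: x(2) o_def)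
  with lr(1) show "\<exists>l r. strict_mono r \<and> (c \<circ> r) \<longlonglongrightarrow> l" by blast
qed

section \<open>Lifts and derivatives of torus maps\<close>

lemma torus_proj_eq_iff:
  "torus_proj x = torus_proj y \<longleftrightarrow> cis (fst x) = cis (fst y) \<and> cis (snd x) = cis (snd y)"
  by (cases x; cases y) (simp add: torus_proj_def abs_circle_eq_iff)

lemma torus_proj_surj: obtains x where "z = torus_proj x"
proof (cases z)
  case (Pair c d)
  then show ?thesis
    using that [of "(rep_circle c, rep_circle d)"] by (simp add: torus_proj_def)
qed

lemma continuous_on_torus_proj [continuous_intros]:
  "continuous_on S g \<Longrightarrow> continuous_on S (\<lambda>x. torus_proj (g x))"
  unfolding torus_proj_def map_prod_def split_beta by (intro continuous_intros)

lemma torus_proj_add_cong: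
  "torus_proj x = torus_proj x' \<Longrightarrow> torus_proj y = torus_proj y' \<Longrightarrow>
    torus_proj (x + y) = torus_proj (x' + y')"
  by (simp add: torus_proj_eq_iff flip: cis_mult)

lemma torus_proj_diff_cong:
  "torus_proj x = torus_proj x' \<Longrightarrow> torus_proj y = torus_proj y' \<Longrightarrow>
    torus_proj (x - y) = torus_proj (x' - y')"
  by (simp add: torus_proj_eq_iff flip: cis_divide)

lemma torus_proj_shift:
  "torus_proj a = torus_proj b \<Longrightarrow> torus_proj (x + (b - a)) = torus_proj x"
  using torus_proj_add_cong [of x x "b - a" 0] torus_proj_diff_cong [of b a a a] by simp

lemma cis_eq_close: "cis x = cis y \<Longrightarrow> \<bar>x - y\<bar> < 2 * pi \<Longrightarrow> x = y"
proof -
  assume "cis x = cis y" and lt: "\<bar>x - y\<bar> < 2 * pi"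
  then obtain k :: int where k: "x - y = 2 * pi * of_int k"
    by (auto simp: cis_eq_iff_2pi_multiple)
  then have "\<bar>of_int k :: real\<bar> < 1" using lt by (simp add: abs_mult)
  then have "k = 0" by linarith
  then show "x = y" using k by simp
qed

lemma torus_proj_eq_close: "torus_proj x = torus_proj y \<Longrightarrow> dist x y < 2 * pi \<Longrightarrow> x = y"
  using dist_fst_le [of x y] dist_snd_le [of x y] unfolding torus_proj_eq_iff
  by (intro prod_eqI cis_eq_close) (auto simp: dist_real_def)

definition local_torus_lift ::
    "(torus \<Rightarrow> torus) \<Rightarrow> (real \<times> real \<Rightarrow> real \<times> real) \<Rightarrow> real \<times> real \<Rightarrow> bool" where
  "local_torus_lift f F a \<longleftrightarrow> (\<forall>\<^sub>F x in nhds a. torus_proj (F x) = f (torus_proj x))"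

lemma local_torus_liftD: "local_torus_lift f F a \<Longrightarrow> torus_proj (F a) = f (torus_proj a)"
  unfolding local_torus_lift_def by (rule eventually_nhds_x_imp_x)

text \<open>Deck transformations act on source and target: both \<open>a - b\<close> and
  \<open>d - c\<close> are lattice vectors.\<close>

lemma local_torus_lift_shift:
  assumes F: "local_torus_lift f F a" and ab: "torus_proj a = torus_proj b"
    and cd: "torus_proj c = torus_proj d"
  shows "local_torus_lift f (\<lambda>x. F (x + (a - b)) + (d - c)) b"
proof -
  have "((\<lambda>x. x + (a - b)) \<longlongrightarrow> b + (a - b)) (nhds b)"
    by (intro tendsto_intros filterlim_ident)
  then have "filterlim (\<lambda>x. x + (a - b)) (nhds a) (nhds b)" by simp
  with F have "\<forall>\<^sub>F x in nhds b. torus_proj (F (x + (a - b))) = f (torus_proj (x + (a - b)))"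
    unfolding local_torus_lift_def filterlim_iff by blast
  then show ?thesis
    unfolding local_torus_lift_def
    by eventually_elim (simp add: torus_proj_shift [OF cd] torus_proj_shift [OF ab [symmetric]])
qed

text \<open>The difference of two continuous lifts has values in the lattice, whose nonzero vectors
  have length at least 2\<pi>; hence it is constant near \<open>a\<close>.\<close>

lemma local_torus_lift_unique:
  assumes F: "local_torus_lift f F a" "isCont F a"
    and G: "local_torus_lift f G a" "isCont G a"
  shows "\<forall>\<^sub>F x in nhds a. G x = F x + (G a - F a)"
proof -
  have "isCont (\<lambda>x. G x - F x) a"
    using F G by (intro continuous_intros)
  then have "((\<lambda>x. G x - F x) \<longlongrightarrow> G a - F a) (nhds a)"
    unfolding continuous_at by (rule tendsto_at_iff_tendsto_nhds [THEN iffD1])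
  then have "\<forall>\<^sub>F x in nhds a. dist (G x - F x) (G a - F a) < 2 * pi"
    by (rule tendstoD) simp
  then show ?thesis
    using F(1) G(1) unfolding local_torus_lift_def
  proof eventually_elim
    case (elim x)
    have "torus_proj (G x - F x) = torus_proj (G a - F a)"
      using torus_proj_diff_cong [of "G x" "F x" "F x" "F x"] elim
        torus_proj_diff_cong [of "G a" "F a" "F a" "F a"]
        local_torus_liftD [OF F(1)] local_torus_liftD [OF G(1)] by simp
    then have "G x - F x = G a - F a" using elim(1) by (rule torus_proj_eq_close)
    then show ?case by (simp add: algebra_simps)
  qed
qed

lemma has_torus_derivative_iff:
  "has_torus_derivative f A z \<longleftrightarrow>
    (\<exists>a F. torus_proj a = z \<and> local_torus_lift f F a \<and> (F has_derivative blinfun_apply A) (at a))"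
  by (simp add: has_torus_derivative_def local_torus_lift_def)

lemma has_torus_derivative_lift:
  assumes "has_torus_derivative f A (torus_proj b)" and d: "torus_proj d = f (torus_proj b)"
  obtains F where "local_torus_lift f F b" "(F has_derivative blinfun_apply A) (at b)" "F b = d"
proof -
  obtain a F where a: "torus_proj a = torus_proj b" and F: "local_torus_lift f F a"
    and D: "(F has_derivative blinfun_apply A) (at a)"
    using assms by (auto simp: has_torus_derivative_iff)
  have Fa: "torus_proj (F a) = torus_proj d"
    using local_torus_liftD [OF F] d a by simp
  show ?thesis
  proof
    show "local_torus_lift f (\<lambda>x. F (x + (a - b)) + (d - F a)) b"
      by (rule local_torus_lift_shift [OF F a Fa])
    have "((\<lambda>x. x + (a - b)) has_derivative (\<lambda>h. h)) (at b)"
      by (auto intro!: derivative_eq_intros)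
    then have "((\<lambda>x. F (x + (a - b))) has_derivative (\<lambda>h. blinfun_apply A h)) (at b)"
      by (rule has_derivative_compose) (simp add: D)
    then show "((\<lambda>x. F (x + (a - b)) + (d - F a)) has_derivative blinfun_apply A) (at b)"
      by (auto intro!: derivative_eq_intros)
  qed simp
qed

text \<open>Passes from some lift at some base point, as in the definition, to every continuous lift
  at every base point. Uniqueness of the derivative and the derivative of the plane lift both rest
  on this.\<close>

lemma has_torus_derivative_local_lift:
  assumes "has_torus_derivative f A (torus_proj b)" and G: "local_torus_lift f G b" "isCont G b"
  shows "(G has_derivative blinfun_apply A) (at b)"
proof -
  have "torus_proj (G b) = f (torus_proj b)"
    using local_torus_liftD [OF G(1)] .
  then obtain F where F: "local_torus_lift f F b" "(F has_derivative blinfun_apply A) (at b)"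
    "F b = G b"
    using assms(1) has_torus_derivative_lift by blast
  have "\<forall>\<^sub>F x in nhds b. G x = F x"
    using local_torus_lift_unique [OF F(1) has_derivative_continuous [OF F(2)] G] F(3) by simp
  then have "\<forall>\<^sub>F x in at b. F x = G x"
    by (auto simp: eventually_at_filter elim: eventually_mono)
  with F(2) show ?thesis
    by (rule has_derivative_transform_eventually) (use F(3) in auto)
qed

lemma has_torus_derivative_unique:
  assumes "has_torus_derivative f A z" "has_torus_derivative f B z"
  shows "A = B"
proof -
  obtain a F where a: "torus_proj a = z" and F: "local_torus_lift f F a"
    and D: "(F has_derivative blinfun_apply A) (at a)"
    using assms by (auto simp: has_torus_derivative_iff)
  have "(F has_derivative blinfun_apply B) (at a)"
    using has_torus_derivative_local_lift assms(2) a F has_derivative_continuous [OF D] by blast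
  with D show ?thesis
    by (metis blinfun_apply_inject has_derivative_unique)
qed

lemma torus_deriv_eq: "has_torus_derivative f A z \<Longrightarrow> torus_deriv f z = A"
  unfolding torus_deriv_def by (blast intro: has_torus_derivative_unique)

lemma has_torus_derivative_comp:
  assumes f: "has_torus_derivative f A z" and g: "has_torus_derivative g B (f z)"
  shows "has_torus_derivative (g \<circ> f) (B o\<^sub>L A) z"
proof -
  obtain a F where a: "torus_proj a = z" and F: "local_torus_lift f F a"
    and D: "(F has_derivative blinfun_apply A) (at a)"
    using f by (auto simp: has_torus_derivative_iff)
  have Fa: "torus_proj (F a) = f z"
    using local_torus_liftD [OF F] a by simp
  obtain d where "g (f z) = torus_proj d" by (rule torus_proj_surj)
  \<comment> \<open>The lift of \<open>g\<close> is based at \<open>F a\<close>, the point that the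
    lift of \<open>f\<close> actually reaches, so that the two lifts compose.\<close>
  then obtain G where G: "local_torus_lift g G (F a)" "(G has_derivative blinfun_apply B) (at (F a))"
    using g has_torus_derivative_lift [of g B "F a" d] Fa by auto
  have "filterlim F (nhds (F a)) (nhds a)"
    using has_derivative_continuous [OF D]
    unfolding continuous_at by (rule tendsto_at_iff_tendsto_nhds [THEN iffD1])
  then have "\<forall>\<^sub>F x in nhds a. torus_proj (G (F x)) = g (torus_proj (F x))"
    using G(1) unfolding local_torus_lift_def filterlim_iff by blast
  with F have "local_torus_lift (g \<circ> f) (G \<circ> F) a"
    unfolding local_torus_lift_def by eventually_elim simp
  moreover have "(G \<circ> F has_derivative blinfun_apply (B o\<^sub>L A)) (at a)"
    using diff_chain_at [OF D G(2)] by (simp add: blinfun_compose.rep_eq)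
  ultimately show ?thesis using a unfolding has_torus_derivative_iff by blast
qed

lemma has_torus_derivative_id: "has_torus_derivative id id_blinfun z"
proof -
  obtain a where "z = torus_proj a" by (rule torus_proj_surj)
  then show ?thesis
    unfolding has_torus_derivative_iff
    by (intro exI [of _ a] exI [of _ id]) (auto simp: local_torus_lift_def id_def id_blinfun.rep_eq)
qed

text \<open>What the proof uses of \<open>Diff1_torus\<close>, in a form that passes to compositions
  without discussing inverse maps.\<close>

definition torus_immersion :: "(torus \<Rightarrow> torus) \<Rightarrow> bool" where
  "torus_immersion f \<longleftrightarrow>
    inj f \<and> (\<forall>z. has_torus_derivative f (torus_deriv f z) z) \<and> (\<forall>z. inj (blinfun_apply (torus_deriv f z)))"

lemma torus_immersionD:
  assumes "torus_immersion f"
  shows "inj f" "has_torus_derivative f (torus_deriv f z) z" "inj (blinfun_apply (torus_deriv f z))"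
  using assms by (simp_all add: torus_immersion_def del: split_paired_All)

lemma torus_immersion_nonzero: "torus_immersion f \<Longrightarrow> \<xi> \<noteq> 0 \<Longrightarrow> torus_deriv f z \<xi> \<noteq> 0"
  by (metis blinfun.zero_right injD torus_immersionD(3))

lemma torus_immersion_id: "torus_immersion id"
  unfolding torus_immersion_def using torus_deriv_eq [OF has_torus_derivative_id]
  by (simp add: has_torus_derivative_id id_blinfun.rep_eq inj_on_def)

lemma torus_deriv_comp:
  "torus_immersion f \<Longrightarrow> torus_immersion g \<Longrightarrow>
    torus_deriv (g \<circ> f) z = torus_deriv g (f z) o\<^sub>L torus_deriv f z"
  by (intro torus_deriv_eq has_torus_derivative_comp torus_immersionD)

lemma torus_immersion_comp:
  assumes "torus_immersion f" "torus_immersion g"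
  shows "torus_immersion (g \<circ> f)"
  unfolding torus_immersion_def torus_deriv_comp [OF assms]
proof (intro conjI allI impI)
  show "inj (g \<circ> f)"
    using assms by (intro inj_compose torus_immersionD)
  show "has_torus_derivative (g \<circ> f) (torus_deriv g (f z) o\<^sub>L torus_deriv f z) z" for z
    using assms by (intro has_torus_derivative_comp torus_immersionD)
  show "inj (blinfun_apply (torus_deriv g (f z) o\<^sub>L torus_deriv f z))" for z
    unfolding blinfun_compose.rep_eq using assms by (intro inj_compose torus_immersionD)
qed

lemma torus_immersion_funpow: "torus_immersion f \<Longrightarrow> torus_immersion (f ^^ n)"
  by (induction n) (auto simp: torus_immersion_id torus_immersion_comp simp flip: id_def)

text \<open>The chain rule for \<open>inv f \<circ> f = id\<close> gives the differential of
  \<open>f\<close> a left inverse.\<close>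

lemma Diff1_torus_imp_torus_immersion:
  assumes "f \<in> Diff1_torus"
  shows "torus_immersion f"
  unfolding torus_immersion_def
proof (intro conjI allI impI)
  show "inj f" using assms by (simp add: Diff1_torus_def bij_is_inj)
  fix z
  obtain A where A: "has_torus_derivative f A z"
    using assms by (auto simp: Diff1_torus_def C1_torus_map_def simp del: split_paired_All)
  then show "has_torus_derivative f (torus_deriv f z) z" by (simp add: torus_deriv_eq)
  obtain B where B: "has_torus_derivative (inv f) B (f z)"
    using assms by (auto simp: Diff1_torus_def C1_torus_map_def simp del: split_paired_All)
  have "has_torus_derivative id (B o\<^sub>L A) z"
    using has_torus_derivative_comp [OF A B] \<open>inj f\<close> by simp
  then have "B o\<^sub>L A = id_blinfun" by (rule has_torus_derivative_unique) (rule has_torus_derivative_id)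
  then have "B (A \<xi>) = \<xi>" for \<xi>
    by (metis blinfun_apply_blinfun_compose id_apply id_blinfun.rep_eq)
  then show "inj (blinfun_apply (torus_deriv f z))"
    unfolding torus_deriv_eq [OF A] by (rule inj_on_inverseI)
qed

lemma tangent_map_comp:
  "torus_immersion f \<Longrightarrow> torus_immersion g \<Longrightarrow> tangent_map (g \<circ> f) = tangent_map g \<circ> tangent_map f"
  by (auto simp: tangent_map_def torus_deriv_comp)

lemma tangent_map_id: "tangent_map id = id"
  using torus_deriv_eq [OF has_torus_derivative_id]
  by (auto simp: tangent_map_def id_blinfun.rep_eq)

lemma tangent_map_funpow: "torus_immersion f \<Longrightarrow> tangent_map (f ^^ n) = tangent_map f ^^ n"
proof (induction n)
  case (Suc n)
  then show ?case
    using tangent_map_comp [OF torus_immersion_funpow [OF Suc.prems] Suc.prems, of n]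
    by (simp only: funpow.simps)
qed (simp add: tangent_map_id flip: id_def)

section \<open>Continuity of the extended isotopy\<close>

text \<open>Uncurrying for a locally compact source: a closed ball around \<open>p\<close> is a
  compact set that \<open>T t\<close> sends into \<open>U\<close>, so nearby times keep the whole
  ball in \<open>U\<close>.\<close>

lemma continuous_map_compact_open_jointly:
  fixes T :: "'a::topological_space \<Rightarrow> 'b::heine_borel \<Rightarrow> 'c::topological_space"
  assumes T: "continuous_map (top_of_set S) compact_open_topology T"
  shows "continuous_on (S \<times> UNIV) (\<lambda>(t, p). T t p)"
  unfolding continuous_on_topological
proof (intro ballI allI impI)
  fix q U assume "q \<in> S \<times> (UNIV :: 'b set)" and U: "open U" "(case q of (t, p) \<Rightarrow> T t p) \<in> U"
  then obtain t p where q: "q = (t, p)" "t \<in> S" "T t p \<in> U" by auto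
  have "T t \<in> topspace compact_open_topology"
    using T \<open>t \<in> S\<close> by (auto simp: continuous_map_def)
  then have "continuous_on UNIV (T t)"
    by (auto simp: compact_open_topology_def)
  then have "open (T t -` U)"
    using U(1) by (simp add: open_vimage continuous_on_open_vimage)
  then obtain e where e: "e > 0" "cball p e \<subseteq> T t -` U"
    using q(3) by (metis open_contains_cball vimageI2)
  define W where "W = {g. continuous_on UNIV g \<and> g ` cball p e \<subseteq> U}"
  have "openin compact_open_topology W"
    unfolding compact_open_topology_def W_def
    using U(1) compact_cball by (intro topology_generated_by_Basis) blast
  then have "openin (top_of_set S) {s \<in> S. T s \<in> W}"
    using T by (auto simp: continuous_map_def)
  then obtain V where V: "open V" "{s \<in> S. T s \<in> W} = S \<inter> V"
    by (auto simp: openin_open)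
  have "T t \<in> W"
    using \<open>continuous_on UNIV (T t)\<close> e by (auto simp: W_def)
  show "\<exists>A. open A \<and> q \<in> A \<and> (\<forall>y\<in>S \<times> UNIV. y \<in> A \<longrightarrow> (case y of (t, p) \<Rightarrow> T t p) \<in> U)"
  proof (intro exI [of _ "V \<times> ball p e"] conjI ballI impI)
    show "open (V \<times> ball p e)" using V(1) by (intro open_Times open_ball)
    show "q \<in> V \<times> ball p e" using q V(2) \<open>T t \<in> W\<close> \<open>e > 0\<close> by auto
    fix y assume "y \<in> S \<times> (UNIV :: 'b set)" "y \<in> V \<times> ball p e"
    moreover obtain s x where "y = (s, x)" by (cases y)
    ultimately have "y = (s, x)" "T s \<in> W" "x \<in> cball p e" using V(2) by auto
    then show "(case y of (t, p) \<Rightarrow> T t p) \<in> U" by (auto simp: W_def)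
  qed
qed

locale torus_isotopy =
  fixes F :: "real \<Rightarrow> torus \<Rightarrow> torus" and f :: "torus \<Rightarrow> torus"
  assumes isotopy: "isotopy_from_id F f"
begin

abbreviation E :: "real \<Rightarrow> torus \<Rightarrow> torus" where
  "E \<equiv> extended_isotopy F"

lemma F_0: "F 0 = id" and F_1: "F 1 = f"
  using isotopy by (auto simp: isotopy_from_id_def)

lemma torus_immersion_F: "t \<in> {0..1} \<Longrightarrow> torus_immersion (F t)"
proof -
  assume "t \<in> {0..1}"
  then have "F t \<in> topspace Diff1_topology"
    using isotopy by (auto simp: isotopy_from_id_def continuous_map_def)
  then show ?thesis
    by (auto simp: Diff1_topology_def topspace_pullback_topology Diff1_torus_imp_torus_immersion)
qed

lemma continuous_on_tangent_map_F:
  "continuous_on ({0..1} \<times> UNIV) (\<lambda>(t, p). tangent_map (F t) p)"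
proof (rule continuous_map_compact_open_jointly)
  have "continuous_map Diff1_topology compact_open_topology tangent_map"
    using continuous_map_pullback [OF continuous_map_id, of Diff1_torus tangent_map compact_open_topology]
    by (simp add: Diff1_topology_def)
  then have "continuous_map (top_of_set {0..1}) compact_open_topology (tangent_map \<circ> F)"
    using isotopy by (auto simp: isotopy_from_id_def intro: continuous_map_compose)
  then show "continuous_map (top_of_set {0..1}) compact_open_topology (\<lambda>t. tangent_map (F t))"
    by (simp add: o_def)
qed

text \<open>The closed interval is essential: at \<open>t = 1\<close> the formula for
  \<open>n\<close> agrees with that for \<open>Suc n\<close> at \<open>t = 0\<close>, which makes
  the time strips fit together.\<close>

lemma E_eq: "t \<in> {0..1} \<Longrightarrow> E (real n + t) = F t \<circ> f ^^ n"
proof -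
  assume t: "t \<in> {0..1}"
  show ?thesis
  proof (cases "t = 1")
    case True
    have *: "nat \<lfloor>real n + 1\<rfloor> = Suc n" "frac (real n + 1) = 0" by (auto simp: frac_def)
    show ?thesis unfolding True extended_isotopy_def * by (simp add: F_0 F_1)
  next
    case False
    with t have "\<lfloor>real n + t\<rfloor> = int n" "frac (real n + t) = t" by (auto simp: frac_def floor_eq_iff)
    then show ?thesis by (simp add: extended_isotopy_def F_1)
  qed
qed

lemma E_nat: "E (real n) = f ^^ n"
  using E_eq [of 0 n] by (simp add: F_0)

lemma nonneg_split:
  assumes "0 \<le> (t :: real)" obtains n s where "t = real n + s" "s \<in> {0..1}"
proof
  show "t = real (nat \<lfloor>t\<rfloor>) + frac t" using assms by (simp add: frac_def)
  show "frac t \<in> {0..1}" using frac_lt_1 [of t] by (auto intro: less_imp_le)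
qed

lemma E_add_nat: "0 \<le> t \<Longrightarrow> E (real k + t) = E t \<circ> f ^^ k"
proof -
  assume "0 \<le> t"
  then obtain n s where t: "t = real n + s" "s \<in> {0..1}" by (rule nonneg_split)
  have "real k + t = real (n + k) + s" using t by simp
  then show ?thesis
    using t by (simp only: E_eq) (simp add: funpow_add o_assoc)
qed

lemma torus_immersion_f: "torus_immersion f"
  using torus_immersion_F [of 1] F_1 by simp

lemma torus_immersion_E: "0 \<le> t \<Longrightarrow> torus_immersion (E t)"
  by (elim nonneg_split)
     (auto simp: E_eq intro!: torus_immersion_comp torus_immersion_F torus_immersion_funpow torus_immersion_f)

lemma tangent_map_E:
  "t \<in> {0..1} \<Longrightarrow> tangent_map (E (real n + t)) = tangent_map (F t) \<circ> tangent_map f ^^ n"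
  by (simp add: E_eq tangent_map_comp tangent_map_funpow torus_immersion_F torus_immersion_f
      torus_immersion_funpow)

lemma continuous_on_tangent_map_f: "continuous_on UNIV (tangent_map f)"
proof -
  have "continuous_on UNIV (\<lambda>p. case (1 :: real, p) of (t, p) \<Rightarrow> tangent_map (F t) p)"
    by (rule continuous_on_compose2 [OF continuous_on_tangent_map_F]) (auto intro!: continuous_intros)
  then show ?thesis by (simp add: F_1)
qed

lemma continuous_on_funpow:
  fixes g :: "'a::topological_space \<Rightarrow> 'a"
  shows "continuous_on UNIV g \<Longrightarrow> continuous_on UNIV (g ^^ n)"
proof (induction n)
  case (Suc n)
  then have "continuous_on UNIV (g \<circ> g ^^ n)"
    by (intro continuous_on_compose) (auto elim: continuous_on_subset)
  then show ?case by (simp only: funpow.simps)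
qed (simp add: id_def)

text \<open>Finitely many closed time strips glue; a point at a time below \<open>n\<close> has a
  neighbourhood that meets only the strips up to time \<open>n\<close>.\<close>

lemma continuous_on_tangent_map_E:
  "continuous_on ({0..} \<times> UNIV) (\<lambda>(t, p). tangent_map (E t) p)" (is "continuous_on _ ?T")
proof -
  have step: "continuous_on ({real n..real (Suc n)} \<times> UNIV) ?T" for n
  proof -
    have "continuous_on ({real n..real (Suc n)} \<times> UNIV)
        (\<lambda>q. case (fst q - real n, (tangent_map f ^^ n) (snd q)) of (t, p) \<Rightarrow> tangent_map (F t) p)"
      by (rule continuous_on_compose2 [OF continuous_on_tangent_map_F])
         (auto intro!: continuous_intros continuous_on_compose2 [OF continuous_on_funpow [OF continuous_on_tangent_map_f]])
    moreover have "?T q = (case (fst q - real n, (tangent_map f ^^ n) (snd q)) of (t, p) \<Rightarrow> tangent_map (F t) p)"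
      if "q \<in> {real n..real (Suc n)} \<times> UNIV" for q
      using that tangent_map_E [of "fst q - real n" n] by (auto simp: split_beta)
    ultimately show ?thesis
      by (subst continuous_on_cong [OF refl]) auto
  qed
  have *: "continuous_on ({0..real n} \<times> UNIV) ?T" for n
  proof (induction n)
    case 0
    show ?case by (rule continuous_on_subset [OF step [of 0]]) auto
  next
    case (Suc n)
    have "{0..real (Suc n)} \<times> UNIV = {0..real n} \<times> UNIV \<union> {real n..real (Suc n)} \<times> (UNIV :: (torus \<times> real \<times> real) set)"
      by auto
    then show ?case
      by (metis Suc.IH closed_Times closed_UNIV closed_atLeastAtMost continuous_on_closed_Un step)
  qed
  show ?thesis
    unfolding continuous_on_eq_continuous_within
  proof
    fix q :: "real \<times> torus \<times> real \<times> real"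
    assume "q \<in> {0..} \<times> UNIV"
    then have "0 \<le> fst q" by auto
    obtain n where n: "fst q < real n" using reals_Archimedean2 by blast
    have "continuous (at q within {0..real n} \<times> UNIV) ?T"
      using * [of n] n \<open>0 \<le> fst q\<close> by (cases q) (auto simp: continuous_on_eq_continuous_within)
    moreover have "at q within {0..} \<times> UNIV = at q within {0..real n} \<times> UNIV"
      by (rule at_within_nhd [of _ "{..<real n} \<times> UNIV"]) (use n in \<open>cases q; auto intro!: open_Times\<close>)+
    ultimately show "continuous (at q within {0..} \<times> UNIV) ?T" by simp
  qed
qed

definition dE :: "real \<Rightarrow> torus \<Rightarrow> real \<times> real \<Rightarrow> real \<times> real" where
  "dE t z \<xi> = torus_deriv (E t) z \<xi>"

lemma continuous_on_E:
  assumes "continuous_on S t" "continuous_on S z" "\<And>x. x \<in> S \<Longrightarrow> 0 \<le> t x"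
  shows "continuous_on S (\<lambda>x. E (t x) (z x))"
proof -
  have "continuous_on S (\<lambda>x. fst (case (t x, z x, 0) of (t, p) \<Rightarrow> tangent_map (E t) p))"
    by (intro continuous_on_fst continuous_on_compose2 [OF continuous_on_tangent_map_E])
       (use assms in \<open>auto intro!: continuous_intros\<close>)
  then show ?thesis by (simp add: tangent_map_def)
qed

lemma continuous_on_dE:
  assumes "continuous_on S t" "continuous_on S z" "continuous_on S \<xi>" "\<And>x. x \<in> S \<Longrightarrow> 0 \<le> t x"
  shows "continuous_on S (\<lambda>x. dE (t x) (z x) (\<xi> x))"
proof -
  have "continuous_on S (\<lambda>x. snd (case (t x, z x, \<xi> x) of (t, p) \<Rightarrow> tangent_map (E t) p))"
    by (intro continuous_on_snd continuous_on_compose2 [OF continuous_on_tangent_map_E])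
       (use assms in \<open>auto intro!: continuous_intros\<close>)
  then show ?thesis by (simp add: tangent_map_def dE_def)
qed

lemma dE_nonzero: "0 \<le> t \<Longrightarrow> \<xi> \<noteq> 0 \<Longrightarrow> dE t z \<xi> \<noteq> 0"
  unfolding dE_def by (intro torus_immersion_nonzero torus_immersion_E)

lemma dE_0: "dE 0 z \<xi> = \<xi>"
  using E_nat [of 0] torus_deriv_eq [OF has_torus_derivative_id, of z]
  by (simp add: dE_def id_blinfun.rep_eq flip: id_def)

lemma dE_add_nat: "0 \<le> t \<Longrightarrow> dE (real k + t) z \<xi> = dE t ((f ^^ k) z) (dE (real k) z \<xi>)"
  unfolding dE_def
  by (simp add: E_add_nat E_nat torus_deriv_comp torus_immersion_E torus_immersion_f torus_immersion_funpow)

end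

section \<open>Continuous angles\<close>

definition dirvec :: "real \<Rightarrow> real \<times> real" where
  "dirvec a = (cos a, sin a)"

lemma norm_dirvec [simp]: "norm (dirvec a) = 1"
  by (simp add: dirvec_def norm_Pair)

lemma dirvec_nonzero [simp]: "dirvec a \<noteq> 0"
  using norm_dirvec [of a] by (metis norm_zero zero_neq_one)

lemma dirvec_eq_iff: "dirvec a = dirvec b \<longleftrightarrow> cis a = cis b"
  by (simp add: dirvec_def complex_eq_iff)

lemma continuous_on_dirvec [continuous_intros]:
  "continuous_on S g \<Longrightarrow> continuous_on S (\<lambda>x. dirvec (g x))"
proof (rule continuous_on_compose2 [of UNIV dirvec])
  show "continuous_on UNIV dirvec" unfolding dirvec_def by (intro continuous_intros)
qed auto

lemma polar_direction_unique:
  assumes "v \<noteq> 0" "v = norm v *\<^sub>R dirvec a" "v = norm v *\<^sub>R dirvec b"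
  shows "dirvec a = dirvec b"
proof -
  have "norm v *\<^sub>R dirvec a = norm v *\<^sub>R dirvec b" using assms(2,3) by (rule trans [OF sym])
  then show ?thesis using assms(1) by (simp only: scaleR_cancel_left norm_eq_zero simp_thms)
qed

lemma polar_scaleR: "u = norm u *\<^sub>R dirvec a \<Longrightarrow> c > 0 \<Longrightarrow> v = c *\<^sub>R u \<Longrightarrow> v = norm v *\<^sub>R dirvec a"
  by (metis norm_scaleR abs_of_pos scaleR_scaleR)

text \<open>A convex set is contractible, so a nonvanishing complex function on it has a continuous
  logarithm; the angle is its imaginary part.\<close>

lemma continuous_angle:
  fixes g :: "'a::real_normed_vector \<Rightarrow> real \<times> real"
  assumes "convex S" "continuous_on S g" "\<And>x. x \<in> S \<Longrightarrow> g x \<noteq> 0"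
  obtains A where "continuous_on S A" "\<And>x. x \<in> S \<Longrightarrow> g x = norm (g x) *\<^sub>R dirvec (A x)"
proof -
  have cont: "continuous_on S (\<lambda>x. Complex (fst (g x)) (snd (g x)))"
    unfolding Complex_eq by (intro continuous_intros assms(2))
  have nz: "Complex (fst (g x)) (snd (g x)) \<noteq> 0" if "x \<in> S" for x
    using assms(3) [OF that] by (simp add: complex_eq_iff prod_eq_iff)
  obtain L where L: "continuous_on S L" "\<And>x. x \<in> S \<Longrightarrow> Complex (fst (g x)) (snd (g x)) = exp (L x)"
    using continuous_logarithm_on_contractible [OF cont convex_imp_contractible [OF assms(1)]] nz by metis
  show ?thesis
  proof
    show "continuous_on S (\<lambda>x. Im (L x))" by (intro continuous_intros L(1))
    fix x assume "x \<in> S"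
    have "norm (g x) = cmod (Complex (fst (g x)) (snd (g x)))"
      by (simp add: cmod_def norm_prod_def)
    then have "norm (g x) = exp (Re (L x))" by (simp add: L(2) [OF \<open>x \<in> S\<close>])
    moreover have "fst (g x) = Re (exp (L x))" "snd (g x) = Im (exp (L x))"
      by (simp_all flip: L(2) [OF \<open>x \<in> S\<close>])
    ultimately show "g x = norm (g x) *\<^sub>R dirvec (Im (L x))"
      by (simp add: prod_eq_iff dirvec_def Re_exp Im_exp)
  qed
qed

definition dirvec_circle :: "circle \<Rightarrow> real \<times> real" where
  "dirvec_circle c = (Re (circ c), Im (circ c))"

lemma dirvec_circle_abs [simp]: "dirvec_circle (abs_circle a) = dirvec a"
  by (simp add: dirvec_circle_def dirvec_def)

lemma dirvec_circle_nonzero [simp]: "dirvec_circle c \<noteq> 0"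
  by (cases c) simp

lemma continuous_on_dirvec_circle [continuous_intros]:
  "continuous_on S g \<Longrightarrow> continuous_on S (\<lambda>x. dirvec_circle (g x))"
  unfolding dirvec_circle_def by (intro continuous_intros)

lemma continuous_circle_lift:
  fixes g :: "'a::real_normed_vector \<Rightarrow> circle"
  assumes "convex S" "continuous_on S g"
  obtains A where "continuous_on S A" "\<And>x. x \<in> S \<Longrightarrow> g x = abs_circle (A x)"
proof -
  obtain A where A: "continuous_on S A"
    "\<And>x. x \<in> S \<Longrightarrow> dirvec_circle (g x) = norm (dirvec_circle (g x)) *\<^sub>R dirvec (A x)"
    using continuous_angle [OF assms(1) continuous_on_dirvec_circle [OF assms(2)]] by auto
  have "g x = abs_circle (A x)" if "x \<in> S" for x
  proof -
    obtain y where y: "g x = abs_circle y" by (cases "g x")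
    then show ?thesis using A(2) [OF that] by (simp add: dirvec_eq_iff abs_circle_eq_iff)
  qed
  with A(1) show ?thesis using that by blast
qed

lemma continuous_torus_lift:
  fixes g :: "'a::real_normed_vector \<Rightarrow> torus"
  assumes "convex S" "continuous_on S g"
  obtains L where "continuous_on S L" "\<And>x. x \<in> S \<Longrightarrow> g x = torus_proj (L x)"
proof -
  obtain A where A: "continuous_on S A" "\<And>x. x \<in> S \<Longrightarrow> fst (g x) = abs_circle (A x)"
    using continuous_circle_lift [OF assms(1) continuous_on_fst [OF assms(2)]] by blast
  obtain B where B: "continuous_on S B" "\<And>x. x \<in> S \<Longrightarrow> snd (g x) = abs_circle (B x)"
    using continuous_circle_lift [OF assms(1) continuous_on_snd [OF assms(2)]] by blast
  show ?thesis
  proof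
    show "continuous_on S (\<lambda>x. (A x, B x))" by (intro continuous_intros A B)
    show "g x = torus_proj (A x, B x)" if "x \<in> S" for x
      using A(2) B(2) that by (simp add: torus_proj_def prod_eq_iff)
  qed
qed

text \<open>Distinct values are at least 2\<pi> apart. This discreteness is behind every comparison
  of two angles or of two lifts below.\<close>

lemma two_pi_multiple_constant:
  fixes h :: "'a::topological_space \<Rightarrow> real"
  assumes "connected S" "continuous_on S h" "\<And>x. x \<in> S \<Longrightarrow> cis (h x) = 1" "x \<in> S" "y \<in> S"
  shows "h x = h y"
proof -
  have "h constant_on S"
  proof (rule continuous_discrete_range_constant [OF assms(1,2)])
    fix x assume "x \<in> S"
    have "\<forall>y. y \<in> S \<and> h y \<noteq> h x \<longrightarrow> 2 * pi \<le> norm (h y - h x)"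
      using cis_eq_close assms(3) \<open>x \<in> S\<close> by (metis not_le real_norm_def)
    then show "\<exists>e>0. \<forall>y. y \<in> S \<and> h y \<noteq> h x \<longrightarrow> e \<le> norm (h y - h x)"
      by (intro exI [of _ "2 * pi"]) simp
  qed
  then show ?thesis using assms(4,5) by (auto simp: constant_on_def)
qed

lemma torus_lattice_constant:
  fixes h :: "'a::topological_space \<Rightarrow> real \<times> real"
  assumes "connected S" "continuous_on S h" "\<And>x. x \<in> S \<Longrightarrow> torus_proj (h x) = torus_proj 0"
    "x \<in> S" "y \<in> S"
  shows "h x = h y"
proof (rule prod_eqI)
  show "fst (h x) = fst (h y)"
    using assms(3) by (intro two_pi_multiple_constant [OF assms(1) continuous_on_fst [OF assms(2)]] assms(4,5))
      (simp add: torus_proj_eq_iff)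
  show "snd (h x) = snd (h y)"
    using assms(3) by (intro two_pi_multiple_constant [OF assms(1) continuous_on_snd [OF assms(2)]] assms(4,5))
      (simp add: torus_proj_eq_iff)
qed

text \<open>Replaces the definite description by the polar equation, the form in which all later
  arguments handle angles.\<close>

lemma oriented_angle_iff:
  assumes "v \<noteq> 0"
  shows "abs_circle r = oriented_angle (1, 0) v \<longleftrightarrow> v = norm v *\<^sub>R dirvec r"
proof -
  have rot: "rotation s (sgn (1, 0)) = dirvec s" for s
    by (simp add: sgn_div_norm norm_Pair rotation_def dirvec_def)
  have sgn: "sgn v = dirvec s \<longleftrightarrow> v = norm v *\<^sub>R dirvec s" for s
    using assms by (metis divideR_right norm_eq_zero sgn_div_norm)
  obtain r0 where r0: "v = norm v *\<^sub>R dirvec r0"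
    using continuous_angle [of "{v}" "\<lambda>x. x"] assms by auto
  have uniq: "abs_circle s = abs_circle r0" if "v = norm v *\<^sub>R dirvec s" for s
    using polar_direction_unique [OF assms that r0] by (simp add: dirvec_eq_iff abs_circle_eq_iff)
  have "oriented_angle (1, 0) v = abs_circle r0"
    unfolding oriented_angle_def rot sgn
  proof (rule the_equality)
    show "\<exists>r. abs_circle r0 = abs_circle r \<and> v = norm v *\<^sub>R dirvec r" using r0 by blast
  qed (use uniq in blast)
  moreover have "v = norm v *\<^sub>R dirvec r" if "abs_circle r = abs_circle r0"
    using that r0 by (simp add: abs_circle_eq_iff flip: dirvec_eq_iff)
  ultimately show ?thesis using uniq by metis
qed

section \<open>Collinearity and bounded relative turning\<close>

definition cross2 :: "real \<times> real \<Rightarrow> real \<times> real \<Rightarrow> real" where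
  "cross2 a b = fst a * snd b - snd a * fst b"

lemma cross2_dirvec: "cross2 (dirvec a) (dirvec b) = sin (b - a)"
  by (simp add: cross2_def dirvec_def sin_diff)

lemma cross2_scaleR: "cross2 (r *\<^sub>R a) (s *\<^sub>R b) = r * s * cross2 a b"
  by (simp add: cross2_def algebra_simps)

lemma cross2_eq_0_iff:
  assumes "a \<noteq> 0"
  shows "cross2 a b = 0 \<longleftrightarrow> (\<exists>k. b = k *\<^sub>R a)"
proof
  assume *: "cross2 a b = 0"
  show "\<exists>k. b = k *\<^sub>R a"
  proof (cases "fst a = 0")
    case True
    with assms have "snd a \<noteq> 0" by (auto simp: prod_eq_iff)
    with * True show ?thesis
      by (intro exI [of _ "snd b / snd a"]) (auto simp: cross2_def prod_eq_iff)
  next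
    case False
    with * show ?thesis
      by (intro exI [of _ "fst b / fst a"]) (auto simp: cross2_def prod_eq_iff field_simps)
  qed
qed (auto simp: cross2_def)

text \<open>Such a path either avoids the multiples of \<pi> or never leaves them. A variation above
  \<pi> would force an interval of values that contains both a multiple and a non-multiple.\<close>

lemma sin_zero_dichotomy_variation:
  fixes w :: "real \<Rightarrow> real"
  assumes "continuous_on {0..t} w" "0 \<le> t"
    and dich: "\<And>r s. r \<in> {0..t} \<Longrightarrow> s \<in> {0..t} \<Longrightarrow> sin (w r) = 0 \<Longrightarrow> sin (w s) = 0"
  shows "\<bar>w t - w 0\<bar> \<le> pi"
proof (rule ccontr)
  define l u where "l = min (w t) (w 0)" and "u = max (w t) (w 0)"
  assume "\<not> \<bar>w t - w 0\<bar> \<le> pi"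
  then have lu: "l + pi < u" by (auto simp: l_def u_def)
  have "is_interval (w ` {0..t})"
    unfolding is_interval_connected_1 by (intro connected_continuous_image assms(1)) simp
  moreover have "l \<in> w ` {0..t}" "u \<in> w ` {0..t}"
    using assms(2) by (auto simp: l_def u_def min_def max_def)
  ultimately have hit: "\<exists>s\<in>{0..t}. w s = y" if "l \<le> y" "y \<le> u" for y
    using that unfolding is_interval_1 by (metis imageE)
  \<comment> \<open>The first multiple of \<pi> at or above \<open>l\<close>; it lies below
    \<open>u\<close> because \<open>u - l\<close> exceeds \<pi>.\<close>
  define k where "k = \<lceil>l / pi\<rceil>"
  have "l / pi \<le> of_int k" "of_int k < l / pi + 1"
    unfolding k_def by linarith+
  then have k: "l \<le> of_int k * pi" "of_int k * pi < l + pi"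
    by (simp_all add: pos_divide_le_eq pos_less_divide_eq distrib_right
        flip: mult_less_cancel_right_pos [OF pi_gt_zero, of "of_int k" "l / pi + 1"])
  \<comment> \<open>Half of the room left below \<open>u\<close>. Capped at \<pi>/2 it puts
    \<open>y\<close> strictly between two consecutive multiples of \<pi>.\<close>
  define d where "d = (u - of_int k * pi) / 2"
  define y where "y = of_int k * pi + min (pi / 2) d"
  have d: "0 < min (pi / 2) d" "min (pi / 2) d < pi" using k lu pi_gt_zero by (auto simp: d_def min_def)
  have "2 * d = u - of_int k * pi" by (simp add: d_def)
  moreover have "y \<le> of_int k * pi + d" by (simp add: y_def)
  ultimately have "y \<le> u" using k lu by linarith
  have "l \<le> y" using k d unfolding y_def by linarith
  then obtain s where s: "s \<in> {0..t}" "w s = y" using hit \<open>y \<le> u\<close> by blast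
  obtain r where r: "r \<in> {0..t}" "w r = of_int k * pi" using hit [of "of_int k * pi"] k lu pi_gt_zero by auto
  have "sin (w r) = 0" using r by (simp add: sin_zero_iff_int2)
  then have "sin y = 0" using dich r s by metis
  then have "sin (min (pi / 2) d) * cos (of_int k * pi) = 0"
    using \<open>sin (w r) = 0\<close> r by (simp add: y_def sin_add mult.commute)
  moreover have "cos (of_int k * pi) \<noteq> 0"
    using sin_zero_norm_cos_one [of "of_int k * pi"] \<open>sin (w r) = 0\<close> r by auto
  ultimately show False using sin_gt_zero [OF d] by simp
qed

section \<open>Descending continuity along open quotient maps\<close>

lemma open_image_map_prod:
  assumes q: "\<And>U. open U \<Longrightarrow> open (q ` U)" and r: "\<And>U. open U \<Longrightarrow> open (r ` U)" and "open S"
  shows "open (map_prod q r ` S)"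
proof (subst open_subopen, intro ballI)
  fix y assume "y \<in> map_prod q r ` S"
  then obtain a b where ab: "(a, b) \<in> S" "y = (q a, r b)" by auto
  then obtain U V where "open U" "open V" "(a, b) \<in> U \<times> V" "U \<times> V \<subseteq> S"
    using open_prod_elim [OF \<open>open S\<close>] by (metis mem_Sigma_iff)
  then have "open (q ` U \<times> r ` V)" "y \<in> q ` U \<times> r ` V" "q ` U \<times> r ` V \<subseteq> map_prod q r ` S"
    using ab q r by (auto intro!: open_Times)
  then show "\<exists>T. open T \<and> y \<in> T \<and> T \<subseteq> map_prod q r ` S" by blast
qed

lemma continuous_on_open_quotient:
  fixes q :: "'a::topological_space \<Rightarrow> 'b::topological_space" and h :: "'b \<Rightarrow> 'c::topological_space"
  assumes q: "\<And>U. open U \<Longrightarrow> open (q ` U)" and "surj q" and h: "continuous_on UNIV (\<lambda>x. h (q x))"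
  shows "continuous_on UNIV h"
proof -
  have "open (h -` U)" if "open U" for U
  proof -
    have "h -` U = q ` (q -` (h -` U))"
      using \<open>surj q\<close> by (simp add: surj_image_vimage_eq)
    also have "q -` (h -` U) = (\<lambda>x. h (q x)) -` U" by auto
    finally have "h -` U = q ` ((\<lambda>x. h (q x)) -` U)" .
    then show ?thesis
      using q [OF open_vimage [OF that h]] by simp
  qed
  then show ?thesis by (simp add: continuous_on_open_vimage)
qed

definition direction_proj :: "(real \<times> real) \<times> real \<Rightarrow> torus \<times> circle" where
  "direction_proj = map_prod torus_proj abs_circle"

lemma surj_direction_proj: "surj direction_proj"
proof -
  have "surj torus_proj" using torus_proj_surj by (metis surjI surj_def)
  moreover have "surj abs_circle" by (metis abs_circle_rep surjI)
  ultimately show ?thesis unfolding direction_proj_def by (simp add: map_prod_surj)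
qed

text \<open>Continuity is checked on the universal cover, where angles lift. Products of quotient
  maps need not be quotient maps, hence the detour through open maps, which are stable under
  products.\<close>

lemma continuous_on_direction_projD:
  "continuous_on UNIV (\<lambda>p. h (direction_proj p)) \<Longrightarrow> continuous_on UNIV h"
  by (rule continuous_on_open_quotient [OF _ surj_direction_proj])
     (auto simp: direction_proj_def torus_proj_def intro!: open_image_map_prod open_abs_circle_image)

section \<open>Angle variation as a cocycle\<close>

context torus_isotopy
begin

lemma is_angle_lift_iff:
  assumes "\<xi> \<noteq> 0"
  shows "is_angle_lift F z \<xi> v \<longleftrightarrow>
    continuous_on {0..} v \<and> (\<forall>t\<ge>0. dE t z \<xi> = norm (dE t z \<xi>) *\<^sub>R dirvec (v t))"
proof -
  have "abs_circle (v t) = oriented_angle (1, 0) (dE t z \<xi>) \<longleftrightarrow>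
      dE t z \<xi> = norm (dE t z \<xi>) *\<^sub>R dirvec (v t)" if "0 \<le> t" for t
    by (rule oriented_angle_iff [OF dE_nonzero [OF that assms]])
  then show ?thesis unfolding is_angle_lift_def dE_def [symmetric] by blast
qed

lemma dE_eq: "dE t z = blinfun_apply (torus_deriv (E t) z)"
  by (simp add: fun_eq_iff dE_def)

lemma linear_dE: "linear (dE t z)"
  unfolding dE_eq by (rule bounded_linear.linear [OF blinfun.bounded_linear_right])

lemma inj_dE: "0 \<le> t \<Longrightarrow> inj (dE t z)"
  unfolding dE_eq by (rule torus_immersionD(3) [OF torus_immersion_E])

lemma cross2_dE_eq_0_iff:
  assumes "\<xi> \<noteq> 0" "0 \<le> t"
  shows "cross2 (dE t z \<xi>) (dE t z \<xi>') = 0 \<longleftrightarrow> cross2 \<xi> \<xi>' = 0"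
proof -
  have "dE t z \<xi>' = k *\<^sub>R dE t z \<xi> \<longleftrightarrow> \<xi>' = k *\<^sub>R \<xi>" for k
    using inj_dE [OF assms(2), of z] by (metis linear_scale [OF linear_dE] injD)
  then show ?thesis
    by (simp add: cross2_eq_0_iff dE_nonzero assms)
qed

text \<open>The angle between the two moving vectors is a multiple of \<pi> exactly when they are
  collinear, and the injective differentials make this hold at all times or at none.\<close>

lemma variation_diff_le:
  assumes v: "is_angle_lift F z \<xi> v" and v': "is_angle_lift F z \<xi>' v'"
    and "\<xi> \<noteq> 0" "\<xi>' \<noteq> 0" "0 \<le> t"
  shows "\<bar>(v t - v 0) - (v' t - v' 0)\<bar> \<le> pi"
proof -
  note lifts = v [unfolded is_angle_lift_iff [OF \<open>\<xi> \<noteq> 0\<close>]] v' [unfolded is_angle_lift_iff [OF \<open>\<xi>' \<noteq> 0\<close>]]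
  have sin: "sin (v' s - v s) = 0 \<longleftrightarrow> cross2 \<xi> \<xi>' = 0" if "0 \<le> s" for s
  proof -
    have *: "dE s z \<xi> = norm (dE s z \<xi>) *\<^sub>R dirvec (v s)" "dE s z \<xi>' = norm (dE s z \<xi>') *\<^sub>R dirvec (v' s)"
      using lifts that by blast+
    have "cross2 (dE s z \<xi>) (dE s z \<xi>') = norm (dE s z \<xi>) * norm (dE s z \<xi>') * sin (v' s - v s)"
      by (subst (1) *(1), subst (1) *(2)) (simp add: cross2_scaleR cross2_dirvec)
    then show ?thesis
      using cross2_dE_eq_0_iff [OF \<open>\<xi> \<noteq> 0\<close> that, of z \<xi>'] dE_nonzero [OF that] assms(3,4) by simp
  qed
  have "\<bar>(v' t - v t) - (v' 0 - v 0)\<bar> \<le> pi"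
  proof (rule sin_zero_dichotomy_variation [OF _ \<open>0 \<le> t\<close>])
    show "continuous_on {0..t} (\<lambda>s. v' s - v s)"
      using lifts by (intro continuous_on_diff) (auto elim: continuous_on_subset)
  qed (use sin in simp)
  then show ?thesis by (simp add: abs_minus_commute algebra_simps)
qed

text \<open>Both lifts solve the same polar equation, so their difference is a continuous multiple
  of 2\<pi>. The factor \<open>c\<close> is there because iterating the differential does not
  preserve unit length; \<open>c = 1\<close> gives independence of the chosen lift.\<close>

lemma variation_eq:
  assumes v: "is_angle_lift F z \<xi> v" and v': "is_angle_lift F z (c *\<^sub>R \<xi>) v'"
    and "\<xi> \<noteq> 0" "c > 0" "0 \<le> t"
  shows "v t - v 0 = v' t - v' 0"
proof -
  have c: "c *\<^sub>R \<xi> \<noteq> 0" using assms by simp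
  note lifts = v [unfolded is_angle_lift_iff [OF \<open>\<xi> \<noteq> 0\<close>]] v' [unfolded is_angle_lift_iff [OF c]]
  have "v t - v' t = v 0 - v' 0"
  proof (rule two_pi_multiple_constant [where S = "{0..}" and h = "\<lambda>s. v s - v' s"])
    show "continuous_on {0..} (\<lambda>s. v s - v' s)" using lifts by (intro continuous_on_diff) auto
    fix s :: real assume "s \<in> {0..}"
    then have s: "0 \<le> s" by simp
    have "dE s z (c *\<^sub>R \<xi>) = norm (dE s z (c *\<^sub>R \<xi>)) *\<^sub>R dirvec (v s)"
      using lifts s assms(4) by (intro polar_scaleR [OF _ \<open>c > 0\<close> linear_scale [OF linear_dE]]) auto
    moreover have "dE s z (c *\<^sub>R \<xi>) = norm (dE s z (c *\<^sub>R \<xi>)) *\<^sub>R dirvec (v' s)"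
      using lifts s by blast
    ultimately have "dirvec (v s) = dirvec (v' s)"
      by (rule polar_direction_unique [OF dE_nonzero [OF s c]])
    then show "cis (v s - v' s) = 1" by (simp add: dirvec_eq_iff flip: cis_divide)
  qed (use \<open>0 \<le> t\<close> in simp_all)
  then show ?thesis by simp
qed

text \<open>Time, point and direction together range over a convex set, so one angle serves all of
  them. Lifts chosen point by point would give no continuity of the variation in the point.\<close>

lemma joint_angle_lift:
  obtains B where "continuous_on ({0..} \<times> UNIV) B"
    "\<And>x a. is_angle_lift F (torus_proj x) (dirvec a) (\<lambda>t. B (t, x, a))"
proof -
  have cont: "continuous_on ({0..} \<times> UNIV) (\<lambda>q. dE (fst q) (torus_proj (fst (snd q))) (dirvec (snd (snd q))))"
    by (intro continuous_on_dE continuous_intros) auto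
  have "convex ({0..} \<times> (UNIV :: ((real \<times> real) \<times> real) set) :: (real \<times> (real \<times> real) \<times> real) set)"
    by (intro convex_Times) auto
  moreover have "dE (fst q) (torus_proj (fst (snd q))) (dirvec (snd (snd q))) \<noteq> 0"
    if "q \<in> {0..} \<times> (UNIV :: ((real \<times> real) \<times> real) set)" for q
    using that by (intro dE_nonzero) auto
  ultimately obtain B where B: "continuous_on ({0..} \<times> UNIV) B"
    "\<And>q. q \<in> {0..} \<times> UNIV \<Longrightarrow>
       dE (fst q) (torus_proj (fst (snd q))) (dirvec (snd (snd q))) =
       norm (dE (fst q) (torus_proj (fst (snd q))) (dirvec (snd (snd q)))) *\<^sub>R dirvec (B q)"
    using continuous_angle [OF _ cont] by blast
  have "is_angle_lift F (torus_proj x) (dirvec a) (\<lambda>t. B (t, x, a))" for x a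
    unfolding is_angle_lift_iff [OF dirvec_nonzero]
  proof (intro conjI allI impI)
    show "continuous_on {0..} (\<lambda>t. B (t, x, a))"
      by (rule continuous_on_compose2 [OF B(1)]) (auto intro!: continuous_intros)
    show "dE t (torus_proj x) (dirvec a) = norm (dE t (torus_proj x) (dirvec a)) *\<^sub>R dirvec (B (t, x, a))"
      if "0 \<le> t" for t
      using B(2) [of "(t, x, a)"] that by (simp only: fst_conv snd_conv mem_Sigma_iff atLeast_iff UNIV_I simp_thms)
  qed
  with B(1) show ?thesis using that by blast
qed

lemma angle_lift_exists: "\<xi> \<noteq> 0 \<Longrightarrow> \<exists>v. is_angle_lift F z \<xi> v"
proof -
  assume "\<xi> \<noteq> 0"
  obtain a where "\<xi> = norm \<xi> *\<^sub>R dirvec a"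
    using continuous_angle [of "{\<xi>}" "\<lambda>x. x"] \<open>\<xi> \<noteq> 0\<close> by auto
  then have eq: "dE t z \<xi> = norm \<xi> *\<^sub>R dE t z (dirvec a)" for t
    by (metis linear_scale linear_dE)
  obtain x where x: "z = torus_proj x" by (rule torus_proj_surj)
  obtain B where "\<And>x a. is_angle_lift F (torus_proj x) (dirvec a) (\<lambda>t. B (t, x, a))"
    using joint_angle_lift by blast
  then have "is_angle_lift F z (dirvec a) (\<lambda>t. B (t, x, a))" by (simp add: x)
  then have "is_angle_lift F z \<xi> (\<lambda>t. B (t, x, a))"
    unfolding is_angle_lift_iff [OF \<open>\<xi> \<noteq> 0\<close>] is_angle_lift_iff [OF dirvec_nonzero]
    using polar_scaleR [OF _ _ eq] \<open>\<xi> \<noteq> 0\<close> by (meson zero_less_norm_iff)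
  then show ?thesis by blast
qed

definition variation :: "nat \<Rightarrow> torus \<Rightarrow> real \<times> real \<Rightarrow> real" where
  "variation n z \<xi> = (let v = (SOME v. is_angle_lift F z \<xi> v) in v (real n) - v 0)"

lemma torsion_at_eq: "torsion_at n F z \<xi> = variation n z \<xi> / real n"
  by (simp add: torsion_at_def variation_def Let_def)

lemma variation_scaled:
  assumes "is_angle_lift F z \<xi> v" "\<xi> \<noteq> 0" "c > 0"
  shows "variation n z (c *\<^sub>R \<xi>) = v (real n) - v 0"
proof -
  have "is_angle_lift F z (c *\<^sub>R \<xi>) (SOME v. is_angle_lift F z (c *\<^sub>R \<xi>) v)"
    using angle_lift_exists [of "c *\<^sub>R \<xi>" z] assms(2,3) by (simp add: someI_ex)
  from variation_eq [OF assms(1) this assms(2,3)] show ?thesis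
    by (simp add: variation_def Let_def)
qed

lemma variation_lift: "is_angle_lift F z \<xi> v \<Longrightarrow> \<xi> \<noteq> 0 \<Longrightarrow> variation n z \<xi> = v (real n) - v 0"
  using variation_scaled [of z \<xi> v 1 n] by simp

lemma variation_diff:
  "\<xi> \<noteq> 0 \<Longrightarrow> \<xi>' \<noteq> 0 \<Longrightarrow> \<bar>variation n z \<xi> - variation n z \<xi>'\<bar> \<le> pi"
proof -
  assume nz: "\<xi> \<noteq> 0" "\<xi>' \<noteq> 0"
  obtain v v' where v: "is_angle_lift F z \<xi> v" "is_angle_lift F z \<xi>' v'"
    using angle_lift_exists nz by meson
  show ?thesis
    unfolding variation_lift [OF v(1) nz(1)] variation_lift [OF v(2) nz(2)]
    using variation_diff_le [OF v nz] by simp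
qed

definition cocycle :: "nat \<Rightarrow> torus \<times> circle \<Rightarrow> real" where
  "cocycle n p = variation n (fst p) (dirvec_circle (snd p))"

text \<open>The action of \<open>f\<close> on oriented tangent directions; \<open>dE 1\<close> is
  the differential of \<open>f\<close> because \<open>E 1 = f\<close>.\<close>

definition skew :: "torus \<times> circle \<Rightarrow> torus \<times> circle" where
  "skew p = (f (fst p), oriented_angle (1, 0) (dE 1 (fst p) (dirvec_circle (snd p))))"

lemma continuous_on_cocycle: "continuous_on UNIV (cocycle n)"
proof (rule continuous_on_direction_projD)
  obtain B where B: "continuous_on ({0..} \<times> UNIV) B"
    "\<And>x a. is_angle_lift F (torus_proj x) (dirvec a) (\<lambda>t. B (t, x, a))"
    using joint_angle_lift by blast
  have "cocycle n (direction_proj p) = B (real n, p) - B (0, p)" for p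
    using variation_lift [OF B(2) dirvec_nonzero, of n "fst p" "snd p"]
    by (simp add: cocycle_def direction_proj_def)
  moreover have "continuous_on UNIV (\<lambda>p. B (real n, p) - B (0, p))"
    by (intro continuous_on_diff continuous_on_compose2 [OF B(1)]) (auto intro!: continuous_intros)
  ultimately show "continuous_on UNIV (\<lambda>p. cocycle n (direction_proj p))" by simp
qed

lemma continuous_on_skew: "continuous_on UNIV skew"
proof (rule continuous_on_direction_projD)
  obtain B where B: "continuous_on ({0..} \<times> UNIV) B"
    "\<And>x a. is_angle_lift F (torus_proj x) (dirvec a) (\<lambda>t. B (t, x, a))"
    using joint_angle_lift by blast
  have "skew (direction_proj p) = (E 1 (torus_proj (fst p)), abs_circle (B (1, p)))" for p
    using B(2) [of "fst p" "snd p"] E_nat [of 1]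
    by (simp add: skew_def direction_proj_def is_angle_lift_def dE_def)
  moreover have "continuous_on UNIV (\<lambda>p. (E 1 (torus_proj (fst p)), abs_circle (B (1, p))))"
    by (intro continuous_intros continuous_on_E continuous_on_compose2 [OF B(1)])
       (auto intro!: continuous_intros)
  ultimately show "continuous_on UNIV (\<lambda>p. skew (direction_proj p))" by simp
qed

lemma fst_skew_funpow: "fst ((skew ^^ n) p) = (f ^^ n) (fst p)"
  by (induction n) (simp_all add: skew_def)

lemma dirvec_oriented_angle:
  assumes "v \<noteq> 0" shows "v = norm v *\<^sub>R dirvec_circle (oriented_angle (1, 0) v)"
proof -
  obtain r where r: "oriented_angle (1, 0) v = abs_circle r" by (cases "oriented_angle (1, 0) v")
  then show ?thesis using oriented_angle_iff [OF assms, of r] by simp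
qed

lemma dE_skew:
  "\<exists>c>0. dE (real n) (fst p) (dirvec_circle (snd p)) = c *\<^sub>R dirvec_circle (snd ((skew ^^ n) p))"
proof (induction n)
  case 0
  show ?case by (intro exI [of _ 1]) (simp add: dE_0)
next
  case (Suc n)
  then obtain c where c: "c > 0"
    "dE (real n) (fst p) (dirvec_circle (snd p)) = c *\<^sub>R dirvec_circle (snd ((skew ^^ n) p))"
    by blast
  define w where "w = dE 1 ((f ^^ n) (fst p)) (dirvec_circle (snd ((skew ^^ n) p)))"
  have "w \<noteq> 0" by (simp add: w_def dE_nonzero)
  have "dE (real n + 1) (fst p) (dirvec_circle (snd p)) = c *\<^sub>R w"
    by (simp add: dE_add_nat c linear_scale [OF linear_dE] w_def)
  also have "w = norm w *\<^sub>R dirvec_circle (oriented_angle (1, 0) w)"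
    by (rule dirvec_oriented_angle) fact
  also have "oriented_angle (1, 0) w = snd ((skew ^^ Suc n) p)"
    by (simp add: w_def skew_def [of "(skew ^^ n) p"] fst_skew_funpow)
  finally have "dE (real (Suc n)) (fst p) (dirvec_circle (snd p)) =
      (c * norm w) *\<^sub>R dirvec_circle (snd ((skew ^^ Suc n) p))"
    by (simp add: add.commute)
  with \<open>c > 0\<close> \<open>w \<noteq> 0\<close> show ?case by (intro exI [of _ "c * norm w"]) auto
qed

text \<open>From time \<open>n\<close> on, the same lift \<open>v\<close>, shifted, is a lift for
  the image vector at the image point. This vector is a positive multiple \<open>c\<close> of the
  unit vector that \<open>skew\<close> records, and rescaling by \<open>inverse c\<close> leaves the
  variation unchanged.\<close>

lemma cocycle_Suc: "cocycle (Suc n) p = cocycle n p + cocycle 1 ((skew ^^ n) p)"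
proof -
  let ?\<xi> = "dirvec_circle (snd p)"
  obtain v where v: "is_angle_lift F (fst p) ?\<xi> v"
    using angle_lift_exists dirvec_circle_nonzero by blast
  obtain c where c: "c > 0" "dE (real n) (fst p) ?\<xi> = c *\<^sub>R dirvec_circle (snd ((skew ^^ n) p))"
    using dE_skew by blast
  have nz: "c *\<^sub>R dirvec_circle (snd ((skew ^^ n) p)) \<noteq> 0" using c(1) by simp
  have "is_angle_lift F ((f ^^ n) (fst p)) (c *\<^sub>R dirvec_circle (snd ((skew ^^ n) p))) (\<lambda>t. v (real n + t))"
    unfolding is_angle_lift_iff [OF nz] unfolding c(2) [symmetric]
  proof (intro conjI allI impI)
    show "continuous_on {0..} (\<lambda>t. v (real n + t))"
      using v by (auto simp: is_angle_lift_def intro!: continuous_intros elim!: continuous_on_compose2)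
    fix t :: real assume "0 \<le> t"
    then show "dE t ((f ^^ n) (fst p)) (dE (real n) (fst p) ?\<xi>) =
        norm (dE t ((f ^^ n) (fst p)) (dE (real n) (fst p) ?\<xi>)) *\<^sub>R dirvec (v (real n + t))"
      unfolding dE_add_nat [OF \<open>0 \<le> t\<close>, symmetric]
      using v [unfolded is_angle_lift_iff [OF dirvec_circle_nonzero]] by (meson add_nonneg_nonneg of_nat_0_le_iff)
  qed
  then have "variation 1 ((f ^^ n) (fst p)) (inverse c *\<^sub>R c *\<^sub>R dirvec_circle (snd ((skew ^^ n) p))) =
      v (real n + real 1) - v (real n + 0)"
    using nz c(1) by (intro variation_scaled) auto
  then have "cocycle 1 ((skew ^^ n) p) = v (real (Suc n)) - v (real n)"
    using c(1) by (simp add: cocycle_def fst_skew_funpow add.commute)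
  moreover have "cocycle m p = v (real m) - v 0" for m
    unfolding cocycle_def by (rule variation_lift [OF v dirvec_circle_nonzero])
  ultimately show ?thesis by simp
qed

lemma cocycle_sum: "cocycle n p = (\<Sum>k<n. cocycle 1 ((skew ^^ k) p))"
proof (induction n)
  case 0
  show ?case by (simp add: cocycle_def variation_def Let_def)
next
  case (Suc n)
  then show ?case by (simp only: cocycle_Suc [of n] sum.lessThan_Suc)
qed

end

section \<open>Points with small angle variation\<close>

context torus_isotopy
begin

text \<open>At time 0 any lift is a translation by a lattice vector, as \<open>E 0 = id\<close>;
  subtracting this vector normalises the lift.\<close>

lemma plane_lift:
  obtains H :: "real \<times> (real \<times> real) \<Rightarrow> real \<times> real" where
    "continuous_on ({0..} \<times> UNIV) H"
    "\<And>t x. 0 \<le> t \<Longrightarrow> torus_proj (H (t, x)) = E t (torus_proj x)"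
    "\<And>x. H (0, x) = x"
proof -
  have "convex ({0..} \<times> (UNIV :: (real \<times> real) set) :: (real \<times> real \<times> real) set)"
    by (intro convex_Times) auto
  moreover have "continuous_on ({0..} \<times> UNIV) (\<lambda>q. E (fst q) (torus_proj (snd q)))"
    by (intro continuous_on_E continuous_intros) auto
  ultimately obtain L where L: "continuous_on ({0..} \<times> UNIV) L"
    and proj_L: "\<And>q. q \<in> {0..} \<times> UNIV \<Longrightarrow> E (fst q) (torus_proj (snd q)) = torus_proj (L q)"
    using continuous_torus_lift by blast
  have E0: "E 0 = id" using E_nat [of 0] by (simp add: id_def)
  have lattice: "torus_proj (L (0, x) - x) = torus_proj 0" for x
    using torus_proj_diff_cong [of "L (0, x)" x x x] proj_L [of "(0, x)"] E0 by simp
  have const: "L (0, x) - x = L (0, 0) - 0" for x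
    by (rule torus_lattice_constant [where S = UNIV and h = "\<lambda>x. L (0, x) - x"])
       (auto intro!: continuous_intros continuous_on_compose2 [OF L] simp: lattice)
  show ?thesis
  proof
    show "continuous_on ({0..} \<times> UNIV) (\<lambda>q. L q - L (0, 0))"
      by (intro continuous_on_diff L continuous_on_const)
    show "torus_proj (L (t, x) - L (0, 0)) = E t (torus_proj x)" if "0 \<le> t" for t x
      using torus_proj_diff_cong [OF refl, of "L (0, 0)" 0 "L (t, x)"] proj_L [of "(t, x)"] lattice [of 0] that
      by simp
    show "L (0, x) - L (0, 0) = x" for x using const [of x] by (simp add: algebra_simps)
  qed
qed

text \<open>The defect is lattice-valued and continuous in time, and vanishes at time 0. This is
  where the isotopy to the identity, and not only the map \<open>f\<close>, is used.\<close>

lemma plane_lift_translate: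
  assumes cont: "continuous_on ({0..} \<times> UNIV) H"
    and proj: "\<And>t x. 0 \<le> t \<Longrightarrow> torus_proj (H (t, x)) = E t (torus_proj x)"
    and H0: "\<And>x. H (0, x) = x"
    and p: "torus_proj p = torus_proj 0" and "0 \<le> t"
  shows "H (t, x + p) = H (t, x) + p"
proof -
  have "H (t, x + p) - H (t, x) - p = H (0, x + p) - H (0, x) - p"
  proof (rule torus_lattice_constant [where S = "{0..}" and h = "\<lambda>t. H (t, x + p) - H (t, x) - p"])
    show "continuous_on {0..} (\<lambda>t. H (t, x + p) - H (t, x) - p)"
      by (intro continuous_intros continuous_on_compose2 [OF cont]) auto
    fix s :: real assume "s \<in> {0..}"
    moreover have "torus_proj (x + p) = torus_proj x" using torus_proj_add_cong [OF refl p] by simp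
    ultimately have "torus_proj (H (s, x + p)) = torus_proj (H (s, x))" using proj by simp
    then have "torus_proj (H (s, x + p) - H (s, x)) = torus_proj 0"
      using torus_proj_diff_cong [of "H (s, x + p)" "H (s, x)" "H (s, x)" "H (s, x)"] by simp
    from torus_proj_diff_cong [OF this p] show "torus_proj (H (s, x + p) - H (s, x) - p) = torus_proj 0"
      by simp
  qed (use \<open>0 \<le> t\<close> in auto)
  then show ?thesis by (simp add: H0 algebra_simps)
qed

text \<open>Points with the same image lie over one point of the torus, so they differ by a lattice
  vector, and the lift carries that vector along unchanged.\<close>

lemma plane_lift_inj:
  assumes cont: "continuous_on ({0..} \<times> UNIV) H"
    and proj: "\<And>t x. 0 \<le> t \<Longrightarrow> torus_proj (H (t, x)) = E t (torus_proj x)"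
    and H0: "\<And>x. H (0, x) = x"
    and "0 \<le> t" "H (t, x) = H (t, y)"
  shows "x = y"
proof -
  have "E t (torus_proj x) = E t (torus_proj y)" using proj assms(4,5) by metis
  then have "torus_proj x = torus_proj y"
    using torus_immersionD(1) [OF torus_immersion_E [OF \<open>0 \<le> t\<close>]] by (simp add: inj_eq)
  then have "torus_proj (x - y) = torus_proj 0"
    using torus_proj_diff_cong [of x y y y] by simp
  from plane_lift_translate [OF cont proj H0 this \<open>0 \<le> t\<close>, of y] assms(5) show ?thesis by simp
qed

lemma plane_lift_derivative:
  assumes cont: "continuous_on ({0..} \<times> UNIV) H"
    and proj: "\<And>t x. 0 \<le> t \<Longrightarrow> torus_proj (H (t, x)) = E t (torus_proj x)"
    and "0 \<le> t"
  shows "((\<lambda>x. H (t, x)) has_derivative dE t (torus_proj x)) (at x)"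
  unfolding dE_eq
proof (rule has_torus_derivative_local_lift)
  show "has_torus_derivative (E t) (torus_deriv (E t) (torus_proj x)) (torus_proj x)"
    by (rule torus_immersionD(2) [OF torus_immersion_E [OF \<open>0 \<le> t\<close>]])
  show "local_torus_lift (E t) (\<lambda>x. H (t, x)) x"
    by (simp add: local_torus_lift_def proj \<open>0 \<le> t\<close>)
  have "continuous_on UNIV (\<lambda>x. H (t, x))"
    by (rule continuous_on_compose2 [OF cont]) (use \<open>0 \<le> t\<close> in \<open>auto intro!: continuous_intros\<close>)
  then show "isCont (\<lambda>x. H (t, x)) x"
    by (simp add: continuous_on_eq_continuous_at del: split_paired_All)
qed

end

text \<open>On its way to 0, a path starting above \<pi> crosses (0, \<pi>), and one starting below
  -\<pi> meets (-2\<pi>, -\<pi>); the sine is positive on both intervals.\<close>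

lemma angle_at_maximum:
  fixes w :: "real \<Rightarrow> real"
  assumes cont: "continuous_on {0..b} w" and "0 < b" "w b = 0"
    and sin: "\<And>s. s \<in> {0<..b} \<Longrightarrow> sin (w s) \<le> 0"
  shows "\<bar>w 0\<bar> \<le> pi"
proof (rule ccontr)
  have hit: "False" if y: "min (w 0) 0 < y" "y < max (w 0) 0" and "0 < sin y" for y
  proof -
    have "\<exists>s\<in>{0..b}. w s = y"
    proof (cases "w 0 \<le> 0")
      case True
      then show ?thesis using IVT' [of w 0 y b] y assms by auto
    next
      case False
      then show ?thesis using IVT2' [of w b y 0] y assms by auto
    qed
    then obtain s where s: "0 \<le> s" "s \<le> b" "w s = y" by auto
    have "s \<noteq> 0" using y s by (auto simp: min_def max_def split: if_splits)
    then show False using sin [of s] s \<open>0 < sin y\<close> by auto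
  qed
  assume "\<not> \<bar>w 0\<bar> \<le> pi"
  then consider "w 0 > pi" | "w 0 < - pi" by linarith
  then show False
  proof cases
    case 1
    then show False using hit [of "pi / 2"] pi_gt_zero by simp
  next
    case 2
    \<comment> \<open>The midpoint of \<open>w 0\<close> and -\<pi>, cut off at -3\<pi>/2 so as to
      stay in (-2\<pi>, -\<pi>).\<close>
    define y where "y = max (- (3 * pi / 2)) ((w 0 - pi) / 2)"
    have y: "w 0 < y" "y < - pi" "- (2 * pi) < y"
      using 2 pi_gt_zero by (auto simp: y_def max_def)
    have "sin (y + 2 * pi) > 0" by (rule sin_gt_zero) (use y in auto)
    then show False using hit [of y] y pi_gt_zero 2 by simp
  qed
qed

section \<open>Chords of the image of a horizontal circle\<close>

context torus_isotopy
begin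

text \<open>
  Hopf's chord argument: the direction of the chord from \<open>x\<close> to \<open>x + s\<close> on the lifted image of a
  horizontal circle interpolates between the tangent direction (\<open>s = 0\<close>) and the constant horizontal
  direction (\<open>s = 2\<pi>\<close>), and at a highest point of the image no chord points upwards.
\<close>

lemma small_variation: "\<exists>z. \<bar>variation n z (1, 0)\<bar> \<le> pi"
proof -
  obtain H where H: "continuous_on ({0..} \<times> UNIV) H"
    and proj: "\<And>t x. 0 \<le> t \<Longrightarrow> torus_proj (H (t, x)) = E t (torus_proj x)"
    and H0: "\<And>x. H (0, x) = x"
    by (rule plane_lift) blast
  define \<gamma> where "\<gamma> t s = H (t, (s, 0))" for t s
  have per: "\<gamma> t (s + 2 * pi) = \<gamma> t s + (2 * pi, 0)" if "0 \<le> t" for t s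
  proof -
    have "torus_proj (2 * pi, 0) = torus_proj 0" by (simp add: torus_proj_eq_iff)
    from plane_lift_translate [OF H proj H0 this that, of "(s, 0)"] show ?thesis
      by (simp add: \<gamma>_def)
  qed
  have cont_\<gamma>: "continuous_on S (\<lambda>s. \<gamma> t s)" if "0 \<le> t" for S t
    unfolding \<gamma>_def using that by (intro continuous_on_compose2 [OF H] continuous_intros) auto
  obtain x where x: "x \<in> {0..2 * pi}" "\<And>s. s \<in> {0..2 * pi} \<Longrightarrow> snd (\<gamma> (real n) s) \<le> snd (\<gamma> (real n) x)"
    using continuous_attains_sup [of "{0..2 * pi}" "\<lambda>s. snd (\<gamma> (real n) s)"]
      continuous_on_snd [OF cont_\<gamma> [of "real n"]] by auto
  \<comment> \<open>Chords start at \<open>x\<close> and may leave the fundamental interval;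
    periodicity of the height brings their end points back.\<close>
  have x_max: "snd (\<gamma> (real n) (x + s)) \<le> snd (\<gamma> (real n) x)" if "s \<in> {0..2 * pi}" for s
  proof (cases "x + s \<le> 2 * pi")
    case True
    then show ?thesis using x that by auto
  next
    case False
    then have "x + s - 2 * pi \<in> {0..2 * pi}" using x(1) that by auto
    then show ?thesis using x(2) per [of "real n" "x + s - 2 * pi"] by auto
  qed
  define D where "D t s = dE t (torus_proj (s, 0)) (1, 0)" for t s
  have deriv: "(\<gamma> t has_vector_derivative D t s) (at s)" if "0 \<le> t" for t s
  proof -
    have "((\<lambda>s. (s, 0 :: real)) has_derivative (\<lambda>h. (h, 0))) (at s)"
      by (auto intro!: derivative_eq_intros)
    from has_derivative_compose [OF this plane_lift_derivative [OF H proj that]]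
    have "(\<gamma> t has_derivative (\<lambda>h. dE t (torus_proj (s, 0)) (h, 0))) (at s)"
      by (simp add: \<gamma>_def [abs_def])
    moreover have "dE t (torus_proj (s, 0)) (h, 0) = h *\<^sub>R D t s" for h
      using linear_scale [OF linear_dE, of t "torus_proj (s, 0)" h "(1, 0)"] by (simp add: D_def)
    ultimately show ?thesis by (simp add: has_vector_derivative_def)
  qed
  \<comment> \<open>The chord divided by \<open>s\<close>, written as an average of tangent vectors:
    this form is continuous up to \<open>s = 0\<close>, where it is the tangent.\<close>
  define Q where "Q q = integral (cbox 0 1) (\<lambda>u. D (fst q) (x + u * snd q))" for q :: "real \<times> real"
  have cont_Q: "continuous_on ({0..} \<times> {0..2 * pi}) Q"
    unfolding Q_def
  proof (rule integral_continuous_on_param)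
    show "continuous_on (({0..} \<times> {0..2 * pi}) \<times> cbox 0 1) (\<lambda>(q, u). D (fst q) (x + u * snd q))"
      unfolding D_def split_beta by (intro continuous_on_dE continuous_intros) auto
  qed
  have Q_chord: "s *\<^sub>R Q (t, s) = \<gamma> t (x + s) - \<gamma> t x" if "0 \<le> t" "0 \<le> s" for t s
  proof -
    have "((\<lambda>u. s *\<^sub>R D t (x + u * s)) has_integral (\<gamma> t (x + 1 * s) - \<gamma> t (x + 0 * s))) {0..1}"
    proof (rule fundamental_theorem_of_calculus)
      fix u :: real
      have "((\<lambda>u. x + u * s) has_vector_derivative s) (at u)"
        by (auto intro!: derivative_eq_intros)
      from vector_diff_chain_at [OF this deriv [OF that(1)]]
      have "((\<lambda>u. \<gamma> t (x + u * s)) has_vector_derivative s *\<^sub>R D t (x + u * s)) (at u)"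
        by (simp add: o_def)
      then show "((\<lambda>u. \<gamma> t (x + u * s)) has_vector_derivative s *\<^sub>R D t (x + u * s)) (at u within {0..1})"
        by (rule has_vector_derivative_at_within)
    qed simp
    from integral_unique [OF this] show ?thesis by (simp add: Q_def)
  qed
  have Q_tangent: "Q (t, 0) = D t x" for t by (simp add: Q_def)
  have Q_start: "Q (0, s) = (1, 0)" for s by (simp add: Q_def D_def dE_0)
  have Q_nz: "Q q \<noteq> 0" if q: "q \<in> {0..} \<times> {0..2 * pi}" for q
  proof (cases "snd q = 0")
    case True
    then show ?thesis using Q_tangent [of "fst q"] q dE_nonzero [of "fst q" "(1, 0)"]
      by (cases q) (auto simp: D_def zero_prod_def)
  next
    case False
    \<comment> \<open>For \<open>snd q = 2 * pi\<close> the two points coincide on the torus, so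
      injectivity of the plane lift is needed and that of \<open>E\<close> would not do.\<close>
    then have "\<gamma> (fst q) (x + snd q) \<noteq> \<gamma> (fst q) x"
      using plane_lift_inj [OF H proj H0, of "fst q" "(x + snd q, 0)" "(x, 0)"] q
      by (auto simp: \<gamma>_def)
    then show ?thesis using Q_chord [of "fst q" "snd q"] q by (cases q) auto
  qed
  have "convex ({0..} \<times> {0..2 * pi} :: (real \<times> real) set)" by (intro convex_Times) auto
  then obtain A where A: "continuous_on ({0..} \<times> {0..2 * pi}) A"
    and Q_A: "\<And>q. q \<in> {0..} \<times> {0..2 * pi} \<Longrightarrow> Q q = norm (Q q) *\<^sub>R dirvec (A q)"
    using continuous_angle [OF _ cont_Q Q_nz] by blast
  have horizontal: "cis (A q) = 1" if "q \<in> {0..} \<times> {0..2 * pi}" "Q q = (1, 0)" for q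
    using Q_A [OF that(1)] by (simp add: that(2) norm_Pair dirvec_def complex_eq_iff)
  have A_start: "A (0, s) = A (0, 0)" if "s \<in> {0..2 * pi}" for s
    by (rule two_pi_multiple_constant [where S = "{0..2 * pi}" and h = "\<lambda>s. A (0, s)"])
       (use that in \<open>auto intro!: continuous_intros continuous_on_compose2 [OF A] horizontal Q_start\<close>)
  have Q_end: "Q (t, 2 * pi) = (1, 0)" if "0 \<le> t" for t
  proof -
    have "(2 * pi) *\<^sub>R Q (t, 2 * pi) = (2 * pi) *\<^sub>R (1, 0)"
      using Q_chord [OF that, of "2 * pi"] per [OF that, of x] by simp
    then show ?thesis unfolding scaleR_cancel_left by simp
  qed
  have A_end: "A (t, 2 * pi) = A (0, 2 * pi)" if "0 \<le> t" for t
    by (rule two_pi_multiple_constant [where S = "{0..}" and h = "\<lambda>t. A (t, 2 * pi)"])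
       (use that in \<open>auto intro!: continuous_intros continuous_on_compose2 [OF A] horizontal Q_end\<close>)
  have "is_angle_lift F (torus_proj (x, 0)) (1, 0) (\<lambda>t. A (t, 0))"
  proof (subst is_angle_lift_iff, simp add: zero_prod_def, intro conjI allI impI)
    show "continuous_on {0..} (\<lambda>t. A (t, 0))"
      by (auto intro!: continuous_intros continuous_on_compose2 [OF A])
    show "dE t (torus_proj (x, 0)) (1, 0) =
        norm (dE t (torus_proj (x, 0)) (1, 0)) *\<^sub>R dirvec (A (t, 0))" if "0 \<le> t" for t
      using Q_A [of "(t, 0)"] that unfolding Q_tangent D_def by simp
  qed
  then have "variation n (torus_proj (x, 0)) (1, 0) = A (real n, 0) - A (0, 0)"
    by (rule variation_lift) (simp add: zero_prod_def)
  \<comment> \<open>The change along the edge \<open>s = 0\<close> of the rectangle is read off the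
    other three edges. The angle is constant on the edges \<open>t = 0\<close> and
    \<open>s = 2 * pi\<close>, so only the chords at time \<open>n\<close> contribute.\<close>
  moreover have "\<bar>A (real n, 0) - A (0, 0)\<bar> \<le> pi"
  proof (rule angle_at_maximum [where w = "\<lambda>s. A (real n, s) - A (0, 0)"])
    show "continuous_on {0..2 * pi} (\<lambda>s. A (real n, s) - A (0, 0))"
      by (auto intro!: continuous_intros continuous_on_compose2 [OF A])
    show "A (real n, 2 * pi) - A (0, 0) = 0" using A_end A_start [of "2 * pi"] by simp
    fix s assume s: "s \<in> {0<..2 * pi}"
    have "s * snd (Q (real n, s)) \<le> 0"
      using arg_cong [OF Q_chord [of "real n" s], of snd] x_max [of s] s by simp
    then have "snd (Q (real n, s)) \<le> 0" using s by (simp add: mult_le_0_iff)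
    moreover have "snd (Q (real n, s)) = norm (Q (real n, s)) * sin (A (real n, s))"
      using arg_cong [OF Q_A [of "(real n, s)"], of snd] s by (simp add: dirvec_def)
    moreover have "norm (Q (real n, s)) > 0" using Q_nz [of "(real n, s)"] s by simp
    ultimately have "sin (A (real n, s)) \<le> 0" by (simp add: mult_le_0_iff)
    moreover have "sin (A (real n, s) - A (0, 0)) = sin (A (real n, s))"
      using horizontal [of "(0, 0)"] Q_start by (simp add: sin_diff complex_eq_iff)
    ultimately show "sin (A (real n, s) - A (0, 0)) \<le> 0" by simp
  qed simp
  ultimately show ?thesis by metis
qed

end

section \<open>Pointwise ergodic theorem\<close>

locale measure_preserving = prob_space M for M :: "'a measure" +
  fixes G :: "'a \<Rightarrow> 'a"
  assumes G_measurable [measurable]: "G \<in> measurable M M" and distr_G: "distr M M G = M"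
begin

definition birkhoff_sum :: "('a \<Rightarrow> real) \<Rightarrow> nat \<Rightarrow> 'a \<Rightarrow> real" where
  "birkhoff_sum h n x = (\<Sum>k<n. h ((G ^^ k) x))"

lemma birkhoff_sum_0 [simp]: "birkhoff_sum h 0 x = 0"
  by (simp add: birkhoff_sum_def)

lemma birkhoff_sum_Suc: "birkhoff_sum h (Suc n) x = h x + birkhoff_sum h n (G x)"
  unfolding birkhoff_sum_def by (subst sum.lessThan_Suc_shift) (simp add: funpow_swap1)

lemma birkhoff_sum_Suc': "birkhoff_sum h (Suc n) x = birkhoff_sum h n x + h ((G ^^ n) x)"
  by (simp add: birkhoff_sum_def)

lemma G_funpow_measurable [measurable]: "G ^^ n \<in> measurable M M"
  by (induction n) (simp_all add: id_def)

lemma G_space: "x \<in> space M \<Longrightarrow> G x \<in> space M"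
  using G_measurable by (rule measurable_space)

lemma birkhoff_sum_measurable [measurable]:
  "h \<in> borel_measurable M \<Longrightarrow> birkhoff_sum h n \<in> borel_measurable M"
  unfolding birkhoff_sum_def [abs_def]
  by (intro borel_measurable_sum measurable_compose [OF G_funpow_measurable])

lemma integral_G:
  fixes h :: "'a \<Rightarrow> real"
  shows "h \<in> borel_measurable M \<Longrightarrow> (\<integral>x. h (G x) \<partial>M) = (\<integral>x. h x \<partial>M)"
  using integral_distr [OF G_measurable, of h] by (simp add: distr_G)

text \<open>
  Garsia's argument: the recursion computes \<open>m\<^sub>n = max\<^sub>k\<^sub>\<le>\<^sub>n S\<^sub>k\<close>, so that \<open>h \<ge> m\<^sub>n - m\<^sub>n \<circ> G\<close>
  wherever \<open>m\<^sub>n > 0\<close>.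
\<close>

fun maximal_sum :: "('a \<Rightarrow> real) \<Rightarrow> nat \<Rightarrow> 'a \<Rightarrow> real" where
  "maximal_sum h 0 x = 0"
| "maximal_sum h (Suc n) x = max 0 (h x + maximal_sum h n (G x))"

lemma maximal_sum_nonneg: "0 \<le> maximal_sum h n x"
  by (cases n) simp_all

lemma maximal_sum_measurable [measurable]:
  "h \<in> borel_measurable M \<Longrightarrow> maximal_sum h n \<in> borel_measurable M"
proof (induction n)
  case (Suc n)
  then have [measurable]: "h \<in> borel_measurable M" "maximal_sum h n \<in> borel_measurable M" by auto
  show ?case unfolding maximal_sum.simps [abs_def] by measurable
qed (simp add: maximal_sum.simps [abs_def])

lemma maximal_sum_mono: "maximal_sum h n x \<le> maximal_sum h (Suc n) x"
proof (induction n arbitrary: x)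
  case (Suc n)
  show ?case using Suc [of "G x"] by (simp add: max_def)
qed simp

lemma birkhoff_sum_le_maximal_sum: "birkhoff_sum h n x \<le> maximal_sum h n x"
proof (induction n arbitrary: x)
  case (Suc n)
  then show ?case by (simp add: birkhoff_sum_Suc le_max_iff_disj)
qed simp

text \<open>The second conjunct carries the induction. Positivity identifies the limit of the sets
  where the \<open>n\<close>-th maximum is positive.\<close>

lemma maximal_sum_pos: "0 < maximal_sum h n x \<Longrightarrow> \<exists>m. 0 < birkhoff_sum h m x \<and> maximal_sum h n x \<le> birkhoff_sum h m x"
proof (induction n arbitrary: x)
  case (Suc n)
  then have *: "0 < h x + maximal_sum h n (G x)" by simp
  show ?case
  proof (cases "0 < maximal_sum h n (G x)")
    case True
    from Suc.IH [OF this] obtain m where "maximal_sum h n (G x) \<le> birkhoff_sum h m (G x)" by blast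
    then show ?thesis using * by (intro exI [of _ "Suc m"]) (simp add: birkhoff_sum_Suc)
  next
    case False
    then have "maximal_sum h n (G x) = 0" using maximal_sum_nonneg [of h n "G x"] by simp
    then show ?thesis using * by (intro exI [of _ "Suc 0"]) (simp add: birkhoff_sum_Suc)
  qed
qed simp

lemma maximal_sum_bounded:
  assumes "\<And>x. \<bar>h x\<bar> \<le> B"
  shows "\<bar>maximal_sum h n x\<bar> \<le> real n * B"
proof (induction n arbitrary: x)
  case (Suc n)
  have "0 \<le> B" using assms [of x] by linarith
  then show ?case using Suc [of "G x"] assms [of x] by (simp add: max_def abs_le_iff algebra_simps)
qed simp

lemma birkhoff_sum_bounded:
  assumes "\<And>x. \<bar>h x\<bar> \<le> B"
  shows "\<bar>birkhoff_sum h n x\<bar> \<le> real n * B"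
  unfolding birkhoff_sum_def
  using sum_norm_bound [of "{..<n}" "\<lambda>k. h ((G ^^ k) x)" B] assms by simp

lemma birkhoff_average_bounded:
  assumes "\<And>x. \<bar>h x\<bar> \<le> B"
  shows "\<bar>birkhoff_sum h n x / real n\<bar> \<le> B"
proof -
  have "0 \<le> B" using assms [of x] by linarith
  then show ?thesis
    using birkhoff_sum_bounded [where h = h, OF assms, of n x] by (cases "n = 0") (simp_all add: field_simps)
qed

text \<open>The pointwise bound integrates to 0 on its smaller side, since \<open>G\<close>
  preserves the measure; then the positivity sets increase with \<open>n\<close> and dominated
  convergence applies.\<close>

lemma maximal_ergodic_inequality:
  assumes h [measurable]: "h \<in> borel_measurable M" and B: "\<And>x. \<bar>h x\<bar> \<le> B"
  shows "0 \<le> (\<integral>x. indicator {x. \<exists>n. 0 < birkhoff_sum h n x} x * h x \<partial>M)"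
proof -
  let ?m = "maximal_sum h"
  have int_m: "integrable M (?m n)" for n
    by (rule integrable_const_bound [of _ "real n * B"]) (use maximal_sum_bounded [OF B] in auto)
  have int_mG: "integrable M (\<lambda>x. ?m n (G x))" for n
    by (rule integrable_const_bound [of _ "real n * B"]) (use maximal_sum_bounded [OF B] in auto)
  have int_h: "integrable M (\<lambda>x. indicator {x. 0 < ?m n x} x * h x)" for n
  proof (rule integrable_const_bound [of _ B])
    have "norm (indicator {x. 0 < ?m n x} x * h x) \<le> B" for x
      using B [of x] by (auto simp: indicator_def)
    then show "AE x in M. norm (indicator {x. 0 < ?m n x} x * h x) \<le> B" by simp
  qed simp
  have pos: "0 \<le> (\<integral>x. indicator {x. 0 < ?m n x} x * h x \<partial>M)" for n
  proof -
    \<comment> \<open>Where the maximum vanishes, the left side is at most 0. Where it is positive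
      it equals \<open>h x + ?m k (G x)\<close> with \<open>n = Suc k\<close>, and
      \<open>?m k\<close> is at most \<open>?m n\<close>.\<close>
    have "?m n x - ?m n (G x) \<le> indicator {x. 0 < ?m n x} x * h x" for x
    proof (cases n)
      case (Suc k)
      then show ?thesis
        using maximal_sum_mono [of h k "G x"] maximal_sum_nonneg [of h n "G x"]
        by (auto simp: indicator_def max_def split: if_splits)
    qed simp
    then have "(\<integral>x. ?m n x - ?m n (G x) \<partial>M) \<le> (\<integral>x. indicator {x. 0 < ?m n x} x * h x \<partial>M)"
      by (intro integral_mono Bochner_Integration.integrable_diff int_m int_mG int_h)
    moreover have "(\<integral>x. ?m n x - ?m n (G x) \<partial>M) = 0"
      using integral_G [of "?m n"] by (simp add: int_m int_mG)
    ultimately show ?thesis by simp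
  qed
  have "(\<lambda>n. \<integral>x. indicator {x. 0 < ?m n x} x * h x \<partial>M) \<longlonglongrightarrow>
      (\<integral>x. indicator {x. \<exists>n. 0 < birkhoff_sum h n x} x * h x \<partial>M)"
  proof (rule integral_dominated_convergence [where w = "\<lambda>_. B"])
    show "AE x in M. (\<lambda>n. indicator {x. 0 < ?m n x} x * h x) \<longlonglongrightarrow>
        indicator {x. \<exists>n. 0 < birkhoff_sum h n x} x * h x"
    proof (rule AE_I2)
      fix x
      show "(\<lambda>n. indicator {x. 0 < ?m n x} x * h x) \<longlonglongrightarrow>
          indicator {x. \<exists>n. 0 < birkhoff_sum h n x} x * h x"
      proof (cases "\<exists>n. 0 < birkhoff_sum h n x")
        case True
        then obtain n where n: "0 < birkhoff_sum h n x" by blast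
        have "0 < ?m k x" if "n \<le> k" for k
          using lift_Suc_mono_le [of "\<lambda>n. ?m n x", OF maximal_sum_mono that]
            birkhoff_sum_le_maximal_sum [of h n x] n by linarith
        then have "eventually (\<lambda>k. indicator {x. 0 < ?m k x} x * h x = h x) sequentially"
          unfolding eventually_sequentially by (intro exI [of _ n]) simp
        then show ?thesis using True by (simp add: tendsto_eventually)
      next
        case False
        then have "\<not> 0 < ?m k x" for k using maximal_sum_pos by blast
        then show ?thesis using False by simp
      qed
    qed
    have "norm (indicator {x. 0 < ?m n x} x * h x) \<le> B" for x n
      using B [of x] by (auto simp: indicator_def split: if_splits)
    then show "AE x in M. norm (indicator {x. 0 < ?m n x} x * h x) \<le> B" for n by simp
  qed auto
  then show ?thesis
    by (rule LIMSEQ_le_const) (use pos in blast)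
qed

text \<open>The maximal inequality for \<open>h - b\<close> cut off to \<open>C\<close>: by
  invariance the cut-off passes to the sums, so these vanish outside \<open>C\<close>, and
  \<open>C\<close> is exactly the set where some sum is positive.\<close>

lemma invariant_set_average:
  assumes h [measurable]: "h \<in> borel_measurable M" and B: "\<And>x. \<bar>h x\<bar> \<le> B"
    and C [measurable]: "C \<in> sets M" and inv: "\<And>x. x \<in> space M \<Longrightarrow> G x \<in> C \<longleftrightarrow> x \<in> C"
    and sup: "\<And>x. x \<in> C \<Longrightarrow> \<exists>n. real n * b < birkhoff_sum h n x"
  shows "b * measure M C \<le> (\<integral>x. indicator C x * h x \<partial>M)"
proof -
  define g where "g x = indicator C x * (h x - b)" for x
  have g_eq: "g x = indicator C x * (h x - b)" for x by (simp add: g_def)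
  have [measurable]: "g \<in> borel_measurable M" unfolding g_def [abs_def] by measurable
  have g: "birkhoff_sum g n x = indicator C x * (birkhoff_sum h n x - real n * b)" if "x \<in> space M" for n x
    using that
  proof (induction n arbitrary: x)
    case (Suc n)
    have "birkhoff_sum g (Suc n) x = g x + indicator C (G x) * (birkhoff_sum h n (G x) - real n * b)"
      using Suc.IH [OF G_space [OF Suc.prems]] by (simp only: birkhoff_sum_Suc)
    then show ?case
      using inv [OF Suc.prems] by (cases "x \<in> C") (simp_all add: birkhoff_sum_Suc [of h] g_eq [of x] algebra_simps)
  qed simp
  have "\<bar>g x\<bar> \<le> B + \<bar>b\<bar>" for x using B [of x] by (auto simp: g_def indicator_def)
  from maximal_ergodic_inequality [OF _ this]
  have "0 \<le> (\<integral>x. indicator {x. \<exists>n. 0 < birkhoff_sum g n x} x * g x \<partial>M)" by simp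
  also have "\<dots> = (\<integral>x. indicator C x * h x - b * indicator C x \<partial>M)"
  proof (rule Bochner_Integration.integral_cong [OF refl])
    fix x assume "x \<in> space M"
    show "indicator {x. \<exists>n. 0 < birkhoff_sum g n x} x * g x = indicator C x * h x - b * indicator C x"
    proof (cases "x \<in> C")
      case True
      obtain n where "real n * b < birkhoff_sum h n x" using sup [OF True] by blast
      then have "0 < birkhoff_sum g n x" using True by (simp add: g [OF \<open>x \<in> space M\<close>])
      then have "\<exists>n. 0 < birkhoff_sum g n x" by blast
      then show ?thesis using True by (simp add: g_def)
    qed (simp add: g_def)
  qed
  also have "\<dots> = (\<integral>x. indicator C x * h x \<partial>M) - b * measure M C"
  proof -
    have "norm (indicator C x * h x) \<le> B" for x using B [of x] by (auto simp: indicator_def)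
    then have "integrable M (\<lambda>x. indicator C x * h x)"
      by (intro integrable_const_bound [of _ B]) auto
    moreover have "integrable M (indicator C :: 'a \<Rightarrow> real)"
      by (rule integrable_const_bound [of _ 1]) auto
    ultimately show ?thesis by (subst Bochner_Integration.integral_diff) simp_all
  qed
  finally show ?thesis by simp
qed

text \<open>Where the averages oscillate below \<open>a\<close> and above \<open>b\<close> with
  \<open>a < b\<close>, an invariant set \<open>C\<close> arises. The preceding lemma for
  \<open>h\<close> and for \<open>- h\<close> bounds the integral of \<open>h\<close> over
  \<open>C\<close> below by \<open>b * measure M C\<close> and above by
  \<open>a * measure M C\<close>, so \<open>C\<close> is null.\<close>

theorem birkhoff_convergent:
  assumes h [measurable]: "h \<in> borel_measurable M" and B: "\<And>x. \<bar>h x\<bar> \<le> B"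
  shows "AE x in M. convergent (\<lambda>n. birkhoff_sum h n x / real n)"
proof -
  define A where "A n x = birkhoff_sum h n x / real n" for n x
  have [measurable]: "A n \<in> borel_measurable M" for n unfolding A_def [abs_def] by measurable
  have A_bound: "\<bar>A n x\<bar> \<le> B" for n x
    unfolding A_def by (rule birkhoff_average_bounded [OF B])
  have A_G: "A n (G x) = (h ((G ^^ n) x) - h x) / real n + A n x" for n x
    using birkhoff_sum_Suc [of h n x] birkhoff_sum_Suc' [of h n x] by (simp add: A_def flip: add_divide_distrib)
  have "(\<lambda>n. (h ((G ^^ n) x) - h x) / real n) \<longlonglongrightarrow> 0" for x
  proof (rule Lim_null_comparison)
    have "\<bar>h ((G ^^ n) x) - h x\<bar> \<le> 2 * B" for n using B [of x] B [of "(G ^^ n) x"] by linarith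
    then show "\<forall>\<^sub>F n in sequentially. norm ((h ((G ^^ n) x) - h x) / real n) \<le> 2 * B / real n"
      by (intro always_eventually allI) (simp add: divide_right_mono)
    show "(\<lambda>n. 2 * B / real n) \<longlonglongrightarrow> 0" by (rule lim_const_over_n)
  qed
  then have null: "(\<lambda>n. ereal ((h ((G ^^ n) x) - h x) / real n)) \<longlonglongrightarrow> 0" for x
    by (simp add: zero_ereal_def)
  have limsup_G: "limsup (\<lambda>n. ereal (A n (G x))) = limsup (\<lambda>n. ereal (A n x))" for x
    using ereal_limsup_lim_add [OF null [of x], of "\<lambda>n. ereal (A n x)"] by (simp add: A_G)
  have liminf_G: "liminf (\<lambda>n. ereal (A n (G x))) = liminf (\<lambda>n. ereal (A n x))" for x
    using ereal_liminf_lim_add [OF null [of x], of "\<lambda>n. ereal (A n x)"] by (simp add: A_G)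
  have null_set: "AE x in M. \<not> (liminf (\<lambda>n. ereal (A n x)) < ereal a \<and> ereal b < limsup (\<lambda>n. ereal (A n x)))"
    if "a < b" for a b :: real
  proof -
    define C where "C = {x \<in> space M. liminf (\<lambda>n. ereal (A n x)) < ereal a \<and> ereal b < limsup (\<lambda>n. ereal (A n x))}"
    have C [measurable]: "C \<in> sets M" unfolding C_def by measurable
    have inv: "G x \<in> C \<longleftrightarrow> x \<in> C" if "x \<in> space M" for x
      using that G_space by (simp add: C_def limsup_G liminf_G)
    have "b * measure M C \<le> (\<integral>x. indicator C x * h x \<partial>M)"
    proof (rule invariant_set_average [OF h B C inv])
      fix x assume "x \<in> C"
      then have "ereal b < limsup (\<lambda>n. ereal (A n x))" by (simp add: C_def)
      then have "\<not> (\<forall>\<^sub>F n in sequentially. ereal (A n x) \<le> ereal b)"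
        using Limsup_bounded [of "\<lambda>n. ereal (A n x)" "ereal b" sequentially] by (auto simp: not_le)
      \<comment> \<open>Index 0 has to be avoided: \<open>A 0 x\<close> is 0 by the convention for
        division and says nothing about the sums.\<close>
      then have "\<not> (\<forall>n\<ge>1. ereal (A n x) \<le> ereal b)" unfolding eventually_sequentially by blast
      then obtain n where "n \<ge> 1" "b < A n x" by auto
      then show "\<exists>n. real n * b < birkhoff_sum h n x"
        by (intro exI [of _ n]) (simp add: A_def field_simps)
    qed
    moreover have "- a * measure M C \<le> (\<integral>x. indicator C x * - h x \<partial>M)"
    proof (rule invariant_set_average [OF _ _ C inv])
      fix x assume "x \<in> C"
      then have "liminf (\<lambda>n. ereal (A n x)) < ereal a" by (simp add: C_def)
      then have "\<not> (\<forall>\<^sub>F n in sequentially. ereal a \<le> ereal (A n x))"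
        using Liminf_bounded [of "ereal a" "\<lambda>n. ereal (A n x)" sequentially] by (auto simp: not_le)
      then have "\<not> (\<forall>n\<ge>1. ereal a \<le> ereal (A n x))" unfolding eventually_sequentially by blast
      then obtain n where "n \<ge> 1" "A n x < a" by auto
      moreover have "birkhoff_sum (\<lambda>x. - h x) n x = - birkhoff_sum h n x"
        by (simp add: birkhoff_sum_def sum_negf)
      ultimately show "\<exists>n. real n * - a < birkhoff_sum (\<lambda>x. - h x) n x"
        by (intro exI [of _ n]) (simp add: A_def field_simps)
    qed (use B in auto)
    ultimately have "(b - a) * measure M C \<le> 0" by (simp add: algebra_simps)
    then have "measure M C = 0" using that by (simp add: mult_le_0_iff measure_le_0_iff)
    then have "AE x in M. x \<notin> C" using C by (intro AE_not_in) (auto simp: null_sets_def emeasure_eq_measure)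
    then show ?thesis by (rule AE_mp) (auto simp: C_def)
  qed
  \<comment> \<open>Rational thresholds keep the number of exceptional null sets countable.\<close>
  have "AE x in M. \<forall>a b :: rat. a < b \<longrightarrow>
      \<not> (liminf (\<lambda>n. ereal (A n x)) < ereal (of_rat a) \<and> ereal (of_rat b) < limsup (\<lambda>n. ereal (A n x)))"
    unfolding AE_all_countable
  proof (intro allI)
    fix a b :: rat
    show "AE x in M. a < b \<longrightarrow> \<not> (liminf (\<lambda>n. ereal (A n x)) < ereal (of_rat a) \<and>
        ereal (of_rat b) < limsup (\<lambda>n. ereal (A n x)))"
      by (cases "a < b") (use null_set [of "of_rat a" "of_rat b"] in \<open>auto simp: of_rat_less\<close>)
  qed
  then have "AE x in M. convergent (\<lambda>n. A n x)"
  proof (rule AE_mp, intro AE_I2 impI)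
    fix x assume *: "\<forall>a b :: rat. a < b \<longrightarrow>
      \<not> (liminf (\<lambda>n. ereal (A n x)) < ereal (of_rat a) \<and> ereal (of_rat b) < limsup (\<lambda>n. ereal (A n x)))"
    let ?l = "liminf (\<lambda>n. ereal (A n x))" and ?u = "limsup (\<lambda>n. ereal (A n x))"
    have "\<not> ?l < ?u"
    proof
      assume "?l < ?u"
      then obtain a :: rat where a: "?l < ereal (of_rat a)" "ereal (of_rat a) < ?u"
        using ereal_dense3 by blast
      then obtain b :: rat where b: "ereal (of_rat a) < ereal (of_rat b)" "ereal (of_rat b) < ?u"
        using ereal_dense3 by blast
      then show False using * a by (auto simp: of_rat_less)
    qed
    then have eq: "?l = ?u" using Liminf_le_Limsup [of sequentially "\<lambda>n. ereal (A n x)"] by simp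
    have "ereal (- B) \<le> ?l" "?u \<le> ereal B"
      using A_bound by (auto intro!: Liminf_bounded Limsup_bounded always_eventually simp: abs_le_iff minus_le_iff)
    then have "\<bar>?l\<bar> \<noteq> \<infinity>" using eq by auto
    then obtain c where "?l = ereal c" by auto
    then have "(\<lambda>n. ereal (A n x)) \<longlonglongrightarrow> ereal c"
      using eq by (intro Liminf_eq_Limsup) auto
    then show "convergent (\<lambda>n. A n x)" by (auto simp: convergent_def)
  qed
  then show ?thesis by (simp add: A_def)
qed

lemma integral_birkhoff_sum:
  assumes h [measurable]: "h \<in> borel_measurable M" and B: "\<And>x. \<bar>h x\<bar> \<le> B"
  shows "(\<integral>x. birkhoff_sum h n x \<partial>M) = real n * (\<integral>x. h x \<partial>M)"
proof (induction n)
  case (Suc n)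
  have "integrable M h" by (rule integrable_const_bound [of _ B]) (use B in auto)
  moreover have "integrable M (\<lambda>x. birkhoff_sum h n (G x))"
    by (rule integrable_const_bound [of _ "real n * B"]) (use birkhoff_sum_bounded [OF B] in auto)
  ultimately show ?case
    using integral_G [of "birkhoff_sum h n"] Suc by (simp add: birkhoff_sum_Suc algebra_simps)
qed simp

text \<open>By invariance all averages with \<open>n \<ge> 1\<close> have the integral of
  \<open>h\<close>, and their uniform bound lets it pass to the limit.\<close>

theorem birkhoff_integral:
  assumes h [measurable]: "h \<in> borel_measurable M" and B: "\<And>x. \<bar>h x\<bar> \<le> B"
  shows "(\<integral>x. lim (\<lambda>n. birkhoff_sum h n x / real n) \<partial>M) = (\<integral>x. h x \<partial>M)"
proof -
  have "(\<lambda>n. \<integral>x. birkhoff_sum h n x / real n \<partial>M) \<longlonglongrightarrow> (\<integral>x. lim (\<lambda>n. birkhoff_sum h n x / real n) \<partial>M)"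
  proof (rule integral_dominated_convergence [where w = "\<lambda>_. B"])
    show "(\<lambda>x. lim (\<lambda>n. birkhoff_sum h n x / real n)) \<in> borel_measurable M"
      by (intro borel_measurable_lim_metric) simp
    show "AE x in M. (\<lambda>n. birkhoff_sum h n x / real n) \<longlonglongrightarrow> lim (\<lambda>n. birkhoff_sum h n x / real n)"
      using birkhoff_convergent [OF h B] by (simp add: convergent_LIMSEQ_iff)
    show "AE x in M. norm (birkhoff_sum h n x / real n) \<le> B" for n
      unfolding real_norm_def using birkhoff_average_bounded [where h = h, OF B] by (intro AE_I2)
  qed simp_all
  moreover have "(\<integral>x. birkhoff_sum h n x / real n \<partial>M) = (\<integral>x. h x \<partial>M)" if "n \<ge> 1" for n
    using integral_birkhoff_sum [OF h B, of n] that by simp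
  then have "(\<lambda>n. \<integral>x. birkhoff_sum h n x / real n \<partial>M) \<longlonglongrightarrow> (\<integral>x. h x \<partial>M)"
    by (intro tendsto_eventually) (auto simp: eventually_sequentially)
  ultimately show ?thesis by (rule LIMSEQ_unique)
qed

end

section \<open>Invariant measures from orbit segments\<close>

text \<open>Of period 2, equal to 0 on [0, 1/3] and to 1 on [2/3, 1], since the cosine is at least
  1/2 on the first interval and at most -1/2 on the second. It reads the leading digit of a Cantor
  point continuously.\<close>

definition digit_probe :: "real \<Rightarrow> real" where
  "digit_probe s = max 0 (min 1 (1 / 2 - cos (pi * s)))"

text \<open>For bits \<open>b\<close> this is the point of the Cantor set with ternary digits
  \<open>2 * b j\<close>.\<close>

definition ternary :: "(nat \<Rightarrow> nat) \<Rightarrow> real" where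
  "ternary b = (\<Sum>j. 2 * real (b j) / 3 ^ Suc j)"

context
  fixes b :: "nat \<Rightarrow> nat"
  assumes b: "\<And>j. b j \<le> 1"
begin

lemma summable_ternary: "summable (\<lambda>j. 2 * real (b (j + k)) / 3 ^ Suc j)"
proof (rule summable_comparison_test' [where N = 0])
  show "summable (\<lambda>j. (2 / 3) * (1 / 3) ^ j :: real)"
    by (intro summable_mult summable_geometric) simp
  show "norm (2 * real (b (j + k)) / 3 ^ Suc j) \<le> (2 / 3) * (1 / 3) ^ j" for j
    using b [of "j + k"] by (simp add: power_divide divide_right_mono)
qed

lemma ternary_bounds: "ternary (\<lambda>j. b (j + k)) \<in> {0..1}"
proof -
  have "0 \<le> ternary (\<lambda>j. b (j + k))"
    unfolding ternary_def by (intro suminf_nonneg summable_ternary) simp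
  moreover have "ternary (\<lambda>j. b (j + k)) \<le> (\<Sum>j. (2 / 3) * (1 / 3) ^ j)"
    unfolding ternary_def
  proof (intro suminf_le summable_ternary)
    show "summable (\<lambda>j. (2 / 3) * (1 / 3) ^ j :: real)"
      by (intro summable_mult summable_geometric) simp
    show "2 * real (b (j + k)) / 3 ^ Suc j \<le> (2 / 3) * (1 / 3) ^ j" for j
      using b [of "j + k"] by (simp add: power_divide divide_right_mono)
  qed
  moreover have "(\<Sum>j. (2 / 3) * (1 / 3) ^ j) = (1 :: real)"
    by (subst suminf_mult) (simp_all add: suminf_geometric)
  ultimately show ?thesis by simp
qed

lemma ternary_shift: "3 * ternary (\<lambda>j. b (j + k)) = 2 * real (b k) + ternary (\<lambda>j. b (j + Suc k))"
proof -
  have "ternary (\<lambda>j. b (j + k)) = 2 * real (b k) / 3 + (\<Sum>j. 2 * real (b (Suc j + k)) / 3 ^ Suc (Suc j))"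
    unfolding ternary_def using suminf_split_head [OF summable_ternary [of k]] by simp
  also have "(\<Sum>j. 2 * real (b (Suc j + k)) / 3 ^ Suc (Suc j)) = (\<Sum>j. (1 / 3) * (2 * real (b (j + Suc k)) / 3 ^ Suc j))"
    by simp
  also have "\<dots> = ternary (\<lambda>j. b (j + Suc k)) / 3"
    using suminf_mult [OF summable_ternary [of "Suc k"], of "1 / 3"] by (simp add: ternary_def)
  finally show ?thesis by simp
qed

text \<open>Multiplication by \<open>3 ^ k\<close> shifts digits that are all 0 or 2. The part moved
  in front of the point is therefore even, and a probe of period 2 does not see it.\<close>

lemma ternary_power: "\<exists>m :: nat. 3 ^ k * ternary b = 2 * real m + ternary (\<lambda>j. b (j + k))"
proof (induction k)
  case 0
  show ?case by (intro exI [of _ 0]) simp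
next
  case (Suc k)
  then obtain m :: nat where "3 ^ k * ternary b = 2 * real m + ternary (\<lambda>j. b (j + k))" by blast
  then show ?case
    using ternary_shift [of k] by (intro exI [of _ "3 * m + b k"]) (simp add: algebra_simps)
qed

lemma digit_probe_ternary: "digit_probe (3 ^ k * ternary b) = real (b k)"
proof -
  obtain m :: nat where m: "3 ^ k * ternary b = 2 * real m + ternary (\<lambda>j. b (j + k))"
    using ternary_power by blast
  define r where "r = ternary (\<lambda>j. b (j + k))"
  have r: "3 * r = 2 * real (b k) + ternary (\<lambda>j. b (j + Suc k))" "ternary (\<lambda>j. b (j + Suc k)) \<in> {0..1}"
    unfolding r_def by (rule ternary_shift, rule ternary_bounds)
  have "pi * (3 ^ k * ternary b) = pi * r + (2 * pi) * of_int (int m)"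
    unfolding m r_def by (simp add: algebra_simps)
  then have "cos (pi * (3 ^ k * ternary b)) = cos (pi * r + (2 * pi) * of_int (int m))"
    by simp
  also have "\<dots> = cos (pi * r)"
    by (simp only: cos_add sin_int_2pin cos_int_2pin mult_zero_right mult_1_right diff_zero)
  finally have cos: "cos (pi * (3 ^ k * ternary b)) = cos (pi * r)" .
  consider "b k = 0" | "b k = 1" using b [of k] by linarith
  then show ?thesis
  proof cases
    case 1
    with r have "0 \<le> r" "r \<le> 1 / 3" by auto
    then have "cos (pi / 3) \<le> cos (pi * r)"
      using pi_gt_zero by (intro cos_monotone_0_pi_le) auto
    then show ?thesis using 1 by (simp add: digit_probe_def cos cos_60)
  next
    case 2
    with r have "2 / 3 \<le> r" "r \<le> 1" by auto
    then have "cos (pi * r) \<le> cos (pi * (2 / 3))"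
      using pi_gt_zero by (intro cos_monotone_0_pi_le mult_left_mono) (auto simp: mult_le_cancel_left1)
    moreover have "cos (pi * (2 / 3)) = - 1 / 2"
      using cos_120 by (simp add: mult.commute)
    ultimately show ?thesis using 2 by (simp add: digit_probe_def cos)
  qed
qed

end

lemma binary_expansion:
  fixes x :: real
  assumes "0 \<le> x" "x < 1"
  obtains d :: "nat \<Rightarrow> nat" where "\<And>k. d k \<le> 1" "(\<lambda>k. real (d k) / 2 ^ Suc k) sums x"
proof
  define q where "q k = nat \<lfloor>2 ^ k * x\<rfloor>" for k
  have q: "real (q k) \<le> 2 ^ k * x" "2 ^ k * x < real (q k) + 1" for k
  proof -
    have "real (q k) = of_int \<lfloor>2 ^ k * x\<rfloor>" using assms by (simp add: q_def)
    then show "real (q k) \<le> 2 ^ k * x" "2 ^ k * x < real (q k) + 1" by linarith+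
  qed
  have step: "2 * q k \<le> q (Suc k)" "q (Suc k) \<le> 2 * q k + 1" for k
  proof -
    have "real (2 * q k) < real (q (Suc k) + 1)" "real (q (Suc k)) < real (2 * q k + 2)"
      using q [of k] q [of "Suc k"] by auto
    then show "2 * q k \<le> q (Suc k)" "q (Suc k) \<le> 2 * q k + 1" by linarith+
  qed
  define d where "d k = q (Suc k) - 2 * q k" for k
  show "d k \<le> 1" for k using step [of k] by (simp add: d_def)
  have "q 0 = 0" using assms by (simp add: q_def floor_eq_iff)
  have partial: "(\<Sum>k<n. real (d k) / 2 ^ Suc k) = real (q n) / 2 ^ n" for n
  proof (induction n)
    case (Suc n)
    have "real (d n) = real (q (Suc n)) - 2 * real (q n)"
      using step [of n] by (simp add: d_def of_nat_diff)
    then show ?case using Suc by (simp add: field_simps)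
  qed (simp add: \<open>q 0 = 0\<close>)
  have "(\<lambda>n. real (q n) / 2 ^ n) \<longlonglongrightarrow> x"
  proof (rule tendsto_sandwich [where f = "\<lambda>n. x - (1 / 2) ^ n" and h = "\<lambda>_. x"])
    show "\<forall>\<^sub>F n in sequentially. x - (1 / 2) ^ n \<le> real (q n) / 2 ^ n"
    proof (intro always_eventually allI)
      fix n
      have "x \<le> (real (q n) + 1) / 2 ^ n"
        using q(2) [of n] by (simp add: pos_le_divide_eq mult.commute less_imp_le)
      then show "x - (1 / 2) ^ n \<le> real (q n) / 2 ^ n"
        by (simp add: add_divide_distrib power_divide)
    qed
    show "\<forall>\<^sub>F n in sequentially. real (q n) / 2 ^ n \<le> x"
      using q(1) by (intro always_eventually allI) (simp add: field_simps)
    have "(\<lambda>n. x - (1 / 2) ^ n) \<longlonglongrightarrow> x - 0"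
      by (intro tendsto_diff tendsto_const LIMSEQ_power_zero) simp
    then show "(\<lambda>n. x - (1 / 2) ^ n) \<longlonglongrightarrow> x" by simp
  qed simp
  then show "(\<lambda>k. real (d k) / 2 ^ Suc k) sums x" by (simp only: sums_def partial)
qed

text \<open>
  Schoenberg's space-filling curve: the \<open>i\<close>-th coordinate at a point of the ternary Cantor set reads
  off the digits whose index is congruent to \<open>i\<close> modulo \<open>d\<close>.
\<close>

definition schoenberg :: "nat \<Rightarrow> nat \<Rightarrow> real \<Rightarrow> real" where
  "schoenberg d i t = (\<Sum>k. digit_probe (3 ^ (d * k + i) * t) / 2 ^ Suc k)"

lemma continuous_on_schoenberg: "continuous_on UNIV (schoenberg d i)"
proof -
  have "uniform_limit UNIV (\<lambda>n t. \<Sum>k<n. digit_probe (3 ^ (d * k + i) * t) / 2 ^ Suc k)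
      (\<lambda>t. \<Sum>k. digit_probe (3 ^ (d * k + i) * t) / 2 ^ Suc k) sequentially"
  proof (rule Weierstrass_m_test)
    show "norm (digit_probe (3 ^ (d * k + i) * t) / 2 ^ Suc k) \<le> (1 / 2) * (1 / 2) ^ k" for k t
      by (simp add: digit_probe_def power_divide divide_right_mono)
    show "summable (\<lambda>k. (1 / 2) * (1 / 2) ^ k :: real)"
      by (intro summable_mult summable_geometric) simp
  qed
  moreover have "continuous_on UNIV (\<lambda>t. \<Sum>k<n. digit_probe (3 ^ (d * k + i) * t) / 2 ^ Suc k)" for n
    unfolding digit_probe_def by (intro continuous_intros) auto
  ultimately show ?thesis
    unfolding schoenberg_def [abs_def]
    by (intro uniform_limit_theorem [OF always_eventually]) auto
qed

lemma schoenberg_surj: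
  assumes "0 < d" "\<And>i. i < d \<Longrightarrow> 0 \<le> x i \<and> x i < 1"
  obtains t where "t \<in> {0..1}" "\<And>i. i < d \<Longrightarrow> schoenberg d i t = x i"
proof -
  \<comment> \<open>Indices beyond \<open>d\<close> get zero digits, so that one choice covers all
    \<open>i\<close>.\<close>
  have "\<exists>e :: nat \<Rightarrow> nat. (\<forall>k. e k \<le> 1) \<and> (i < d \<longrightarrow> (\<lambda>k. real (e k) / 2 ^ Suc k) sums x i)" for i
  proof (cases "i < d")
    case True
    then show ?thesis using binary_expansion [of "x i"] assms(2) by metis
  qed (auto intro: exI [of _ "\<lambda>_. 0"])
  then obtain e :: "nat \<Rightarrow> nat \<Rightarrow> nat" where e: "\<And>i k. e i k \<le> 1"
    "\<And>i. i < d \<Longrightarrow> (\<lambda>k. real (e i k) / 2 ^ Suc k) sums x i" by metis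
  \<comment> \<open>Interleaves the \<open>d\<close> digit sequences: position
    \<open>d * k + i\<close> holds the \<open>k\<close>-th digit of coordinate
    \<open>i\<close>.\<close>
  define b where "b j = e (j mod d) (j div d)" for j
  have b: "b j \<le> 1" for j unfolding b_def by (rule e)
  show ?thesis
  proof
    show "ternary b \<in> {0..1}" using ternary_bounds [where b = b and k = 0, OF b] by simp
    fix i assume "i < d"
    have "digit_probe (3 ^ (d * k + i) * ternary b) = real (e i k)" for k
      using digit_probe_ternary [where b = b and k = "d * k + i", OF b] \<open>i < d\<close> by (simp add: b_def)
    then show "schoenberg d i (ternary b) = x i"
      unfolding schoenberg_def using e(2) [OF \<open>i < d\<close>] by (simp add: sums_iff)
  qed
qed

text \<open>Closed sets form a generating family stable under intersection, and their indicators are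
  limits of continuous functions of the distance.\<close>

lemma distr_eq_of_continuous_integrals:
  fixes M :: "'a::metric_space measure" and N :: "'a measure"
  assumes "prob_space M" "prob_space N" and M: "sets M = sets borel" and N: "sets N = sets borel"
    and eq: "\<And>h :: 'a \<Rightarrow> real. continuous_on UNIV h \<Longrightarrow> (\<And>x. 0 \<le> h x \<and> h x \<le> 1) \<Longrightarrow> (\<integral>x. h x \<partial>M) = (\<integral>x. h x \<partial>N)"
  shows "M = N"
proof (rule measure_eqI_generator_eq [where E = "Collect closed" and \<Omega> = UNIV and A = "\<lambda>_. UNIV"])
  interpret M: prob_space M by fact
  interpret N: prob_space N by fact
  show "Int_stable (Collect closed :: 'a set set)" by (auto simp: Int_stable_def)
  show "sets M = sigma_sets UNIV (Collect closed)" "sets N = sigma_sets UNIV (Collect closed)"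
    unfolding M N borel_eq_closed by simp_all
  show "emeasure M UNIV \<noteq> \<infinity>" by simp
  fix C :: "'a set" assume "C \<in> Collect closed"
  then have C: "closed C" by simp
  show "emeasure M C = emeasure N C"
  \<comment> \<open>The empty set is separate because \<open>infdist\<close> to it is 0 by
    convention, which would make the approximating functions constantly 1.\<close>
  proof (cases "C = {}")
    case False
    define h where "h n x = max 0 (1 - real n * infdist x C)" for n x
    have cont: "continuous_on UNIV (h n)" for n
      unfolding h_def [abs_def] by (intro continuous_intros)
    have bound: "0 \<le> h n x \<and> h n x \<le> 1" for n x
      by (simp add: h_def infdist_nonneg)
    have lim: "(\<lambda>n. h n x) \<longlonglongrightarrow> indicator C x" for x
    proof (cases "x \<in> C")
      case True
      then show ?thesis by (simp add: h_def)
    next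
      case False
      then have "0 < infdist x C"
        using C \<open>C \<noteq> {}\<close> in_closed_iff_infdist_zero infdist_nonneg by (metis order_le_imp_less_or_eq)
      then obtain n where n: "1 < real n * infdist x C" using reals_Archimedean3 by metis
      have "h k x = 0" if "n \<le> k" for k
      proof -
        have "real n * infdist x C \<le> real k * infdist x C"
          using that by (intro mult_right_mono infdist_nonneg) auto
        then show ?thesis using n by (simp add: h_def)
      qed
      then have "\<forall>\<^sub>F k in sequentially. h k x = indicator C x"
        using False by (auto simp: eventually_sequentially)
      then show ?thesis by (rule tendsto_eventually)
    qed
    have conv: "(\<lambda>n. \<integral>x. h n x \<partial>L) \<longlonglongrightarrow> measure L C" if "prob_space L" "sets L = sets borel" for L
    proof -
      interpret prob_space L by fact
      have [measurable]: "C \<in> sets L" using C that(2) by simp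
      have "(\<lambda>n. \<integral>x. h n x \<partial>L) \<longlonglongrightarrow> (\<integral>x. indicator C x \<partial>L)"
      proof (rule integral_dominated_convergence [where w = "\<lambda>_. 1"])
        show "h n \<in> borel_measurable L" for n
          using borel_measurable_continuous_onI [OF cont] measurable_cong_sets [OF that(2) refl] by blast
        show "AE x in L. norm (h n x) \<le> 1" for n using bound [of n] by auto
      qed (use lim in auto)
      then show ?thesis by simp
    qed
    have "measure M C = measure N C"
      using conv [OF assms(1) M] conv [OF assms(2) N] unfolding eq [OF cont bound]
      by (rule LIMSEQ_unique)
    then show ?thesis by (simp add: M.emeasure_eq_measure N.emeasure_eq_measure)
  qed simp
qed auto

text \<open>
  Krylov--Bogolyubov along prescribed orbit segments. A parametrisation of the space by an interval
  reduces weak compactness to Helly's selection theorem on the line.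
\<close>

lemma krylov_bogolyubov:
  fixes G :: "'a::metric_space \<Rightarrow> 'a" and \<phi> :: "real \<Rightarrow> 'a" and x :: "nat \<Rightarrow> 'a"
  assumes \<phi>: "continuous_on UNIV \<phi>" and surj: "\<phi> ` {0..1} = UNIV" and G: "continuous_on UNIV G"
  obtains N :: "'a measure" and r :: "nat \<Rightarrow> nat" where
    "prob_space N" "sets N = sets borel" "strict_mono r" "distr N borel G = N"
    "\<And>h :: 'a \<Rightarrow> real. continuous_on UNIV h \<Longrightarrow>
      (\<lambda>n. (\<Sum>k<r n. h ((G ^^ k) (x (r n)))) / real (r n)) \<longlonglongrightarrow> (\<integral>y. h y \<partial>N)"
proof -
  have "\<forall>y. \<exists>t. t \<in> {0..1} \<and> \<phi> t = y" using surj by (metis UNIV_I imageE)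
  \<comment> \<open>An arbitrary section of \<open>\<phi>\<close>, with no measurability claimed: it
    is only evaluated along a discrete measure, and testing with \<open>h \<circ> \<phi>\<close>
    cancels it.\<close>
  then obtain c where c: "\<And>y. c y \<in> {0..1}" "\<And>y. \<phi> (c y) = y" by metis
  \<comment> \<open>Index \<open>n\<close> stands for a segment of \<open>Suc n\<close> points, so
    that no average is empty; hence \<open>r n = Suc (s n)\<close> below.\<close>
  define \<rho> where "\<rho> n = distr (measure_pmf (pmf_of_set {..n})) borel (\<lambda>k. c ((G ^^ k) (x (Suc n))))" for n :: nat
  have \<rho>_integral: "(\<integral>t. g t \<partial>\<rho> n) = (\<Sum>k<Suc n. g (c ((G ^^ k) (x (Suc n))))) / real (Suc n)"
    if "g \<in> borel_measurable borel" for g :: "real \<Rightarrow> real" and n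
    using that by (simp add: \<rho>_def integral_distr integral_pmf_of_set lessThan_Suc_atMost)
  have \<rho>: "real_distribution (\<rho> n)" for n
    unfolding \<rho>_def real_distribution_def real_distribution_axioms_def
    by (auto intro!: prob_space.prob_space_distr measure_pmf.prob_space_axioms)
  have "tight \<rho>"
    unfolding tight_def
  proof (intro conjI allI impI \<rho>)
    fix \<epsilon> :: real assume "\<epsilon> > 0"
    have "measure (\<rho> n) {-1<..2} = 1" for n
    proof -
      have "(\<lambda>k. c ((G ^^ k) (x (Suc n)))) -` {-1<..2} = UNIV"
        using c(1) by (auto simp: less_le_trans [of "-1" 0] order_trans [of _ 1 2])
      then show ?thesis by (simp add: \<rho>_def measure_distr)
    qed
    then show "\<exists>a b. a < b \<and> (\<forall>n. 1 - \<epsilon> < measure (\<rho> n) {a<..b})"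
      using \<open>\<epsilon> > 0\<close> by (intro exI [of _ "-1"] exI [of _ 2]) simp
  qed
  from tight_imp_convergent_subsubsequence [OF this strict_mono_id] obtain s L where
    s: "strict_mono s" and L: "real_distribution L" and conv: "weak_conv_m (\<rho> \<circ> id \<circ> s) L" by auto
  interpret L: real_distribution L by fact
  define r where "r n = Suc (s n)" for n
  have \<phi>_meas: "\<phi> \<in> borel_measurable L" using borel_measurable_continuous_onI [OF \<phi>] by simp
  define N where "N = distr L borel \<phi>"
  have N: "prob_space N" "sets N = sets borel"
    unfolding N_def by (auto intro: L.prob_space_distr \<phi>_meas)
  have lim: "(\<lambda>n. (\<Sum>k<r n. h ((G ^^ k) (x (r n)))) / real (r n)) \<longlonglongrightarrow> (\<integral>y. h y \<partial>N)"
    if h: "continuous_on UNIV h" for h :: "'a \<Rightarrow> real"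
  proof -
    have h\<phi>: "continuous_on UNIV (\<lambda>t. h (\<phi> t))" by (rule continuous_on_compose2 [OF h \<phi>]) simp
    have "compact (h ` \<phi> ` {0..1})"
      by (intro compact_continuous_image compact_Icc continuous_on_subset [OF h] continuous_on_subset [OF \<phi>]) auto
    then obtain B where B: "\<And>y. norm (h y) \<le> B"
      unfolding surj using compact_imp_bounded bounded_iff by (metis rangeI)
    have "(\<lambda>n. \<integral>t. h (\<phi> t) \<partial>(\<rho> \<circ> id \<circ> s) n) \<longlonglongrightarrow> (\<integral>t. h (\<phi> t) \<partial>L)"
      by (rule weak_conv_imp_integral_bdd_continuous_conv [OF _ L conv])
         (use \<rho> h\<phi> B in \<open>auto simp: continuous_on_eq_continuous_at\<close>)
    moreover have "(\<integral>t. h (\<phi> t) \<partial>L) = (\<integral>y. h y \<partial>N)"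
      unfolding N_def using borel_measurable_continuous_onI [OF h] by (intro integral_distr [symmetric] \<phi>_meas)
    ultimately show ?thesis
      using borel_measurable_continuous_onI [OF h\<phi>] by (simp add: \<rho>_integral r_def c(2) o_def)
  qed
  have G_meas: "G \<in> measurable N borel"
    using borel_measurable_continuous_onI [OF G] measurable_cong_sets [OF N(2) refl] by blast
  have "distr N borel G = N"
  proof (rule distr_eq_of_continuous_integrals)
    interpret N: prob_space N by (rule N)
    show "prob_space (distr N borel G)" by (rule N.prob_space_distr [OF G_meas])
    fix h :: "'a \<Rightarrow> real" assume h: "continuous_on UNIV h" and bound: "\<And>x. 0 \<le> h x \<and> h x \<le> 1"
    have hG: "continuous_on UNIV (\<lambda>y. h (G y))" by (rule continuous_on_compose2 [OF h G]) simp
    have "(\<lambda>n. (\<Sum>k<r n. h (G ((G ^^ k) (x (r n))))) / real (r n) - (\<Sum>k<r n. h ((G ^^ k) (x (r n)))) / real (r n))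
        \<longlonglongrightarrow> (\<integral>y. h (G y) \<partial>N) - (\<integral>y. h y \<partial>N)"
      by (intro tendsto_diff lim h hG)
    \<comment> \<open>Telescoping leaves two boundary terms, which the division by the length kills
      in the limit; this makes the limit measure invariant.\<close>
    moreover have "(\<Sum>k<m. h (G ((G ^^ k) y))) - (\<Sum>k<m. h ((G ^^ k) y)) = h ((G ^^ m) y) - h y" for m y
      by (induction m) simp_all
    ultimately have "(\<lambda>n. (h ((G ^^ r n) (x (r n))) - h (x (r n))) / real (r n)) \<longlonglongrightarrow> (\<integral>y. h (G y) \<partial>N) - (\<integral>y. h y \<partial>N)"
      by (simp flip: diff_divide_distrib)
    moreover have "(\<lambda>n. (h ((G ^^ r n) (x (r n))) - h (x (r n))) / real (r n)) \<longlonglongrightarrow> 0"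
    proof (rule Lim_null_comparison)
      have "\<bar>h y - h z\<bar> \<le> 1" for y z using bound [of y] bound [of z] by linarith
      then show "\<forall>\<^sub>F n in sequentially. norm ((h ((G ^^ r n) (x (r n))) - h (x (r n))) / real (r n)) \<le> 1 / real (r n)"
        by (intro always_eventually allI) (simp add: divide_right_mono)
      have "filterlim r at_top sequentially"
        using s unfolding r_def by (intro filterlim_subseq) (simp add: strict_mono_def)
      from filterlim_compose [OF lim_const_over_n [of "1 :: real"] this] show "(\<lambda>n. 1 / real (r n)) \<longlonglongrightarrow> 0" .
    qed
    ultimately have "(\<integral>y. h (G y) \<partial>N) - (\<integral>y. h y \<partial>N) = 0" by (rule LIMSEQ_unique)
    then show "(\<integral>y. h y \<partial>distr N borel G) = (\<integral>y. h y \<partial>N)"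
      using integral_distr [OF G_meas borel_measurable_continuous_onI [OF h]] by simp
  qed (use N in auto)
  moreover have "strict_mono r" using s by (simp add: r_def strict_mono_def)
  ultimately show ?thesis using that N lim by blast
qed

section \<open>Measures of null torsion\<close>

lemma space_filling_curve:
  obtains \<phi> :: "real \<Rightarrow> torus \<times> circle" where "continuous_on UNIV \<phi>" "\<phi> ` {0..1} = UNIV"
proof
  let ?\<phi> = "\<lambda>t. ((abs_circle (2 * pi * schoenberg 3 0 t), abs_circle (2 * pi * schoenberg 3 1 t)),
    abs_circle (2 * pi * schoenberg 3 2 t))"
  show "continuous_on UNIV ?\<phi>"
    by (intro continuous_intros continuous_on_schoenberg)
  have "p \<in> ?\<phi> ` {0..1}" for p :: "torus \<times> circle"
  proof -
    obtain x where x: "0 \<le> x" "x < 1" "fst (fst p) = abs_circle (2 * pi * x)"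
      by (rule abs_circle_fundamental_domain)
    obtain y where y: "0 \<le> y" "y < 1" "snd (fst p) = abs_circle (2 * pi * y)"
      by (rule abs_circle_fundamental_domain)
    obtain w where w: "0 \<le> w" "w < 1" "snd p = abs_circle (2 * pi * w)"
      by (rule abs_circle_fundamental_domain)
    define v :: "nat \<Rightarrow> real" where "v i = (if i = 0 then x else if i = 1 then y else w)" for i
    have "0 \<le> v i \<and> v i < 1" for i using x y w by (simp add: v_def)
    then obtain t where "t \<in> {0..1}" and t: "\<And>i. i < 3 \<Longrightarrow> schoenberg 3 i t = v i"
      using schoenberg_surj [of 3 v] by (metis zero_less_numeral)
    then have "p = ?\<phi> t"
      using x(3) y(3) w(3) t [of 0] t [of 1] t [of 2] by (simp add: v_def prod_eq_iff)
    with \<open>t \<in> {0..1}\<close> show ?thesis by blast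
  qed
  then show "?\<phi> ` {0..1} = UNIV" by blast
qed

section \<open>From the skew product back to the torus\<close>

context torus_isotopy
begin

lemma cocycle_horizontal: "cocycle n (z, abs_circle 0) = variation n z (1, 0)"
  by (simp add: cocycle_def dirvec_def)

text \<open>The variations in two directions stay within \<pi> of each other, which disappears after
  division by \<open>n\<close>.\<close>

lemma torsion_direction_independent:
  assumes "\<xi> \<noteq> 0" "\<xi>' \<noteq> 0" "(\<lambda>n. variation n z \<xi> / real n) \<longlonglongrightarrow> \<tau>"
  shows "(\<lambda>n. variation n z \<xi>' / real n) \<longlonglongrightarrow> \<tau>"
proof -
  have "(\<lambda>n. variation n z \<xi>' / real n - variation n z \<xi> / real n) \<longlonglongrightarrow> 0"
  proof (rule Lim_null_comparison)
    show "\<forall>\<^sub>F n in sequentially. norm (variation n z \<xi>' / real n - variation n z \<xi> / real n) \<le> pi / real n"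
      using variation_diff [OF assms(2,1)]
      by (intro always_eventually allI) (simp add: divide_right_mono flip: diff_divide_distrib)
    show "(\<lambda>n. pi / real n) \<longlonglongrightarrow> 0" by (rule lim_const_over_n)
  qed
  from tendsto_add [OF this assms(3)] show ?thesis by simp
qed

lemma has_torsion_iff:
  assumes "\<xi> \<noteq> 0"
  shows "has_torsion F z \<tau> \<longleftrightarrow> (\<lambda>n. variation n z \<xi> / real n) \<longlonglongrightarrow> \<tau>"
  unfolding has_torsion_def torsion_at_eq
proof
  assume "\<exists>\<xi>'. \<xi>' \<noteq> 0 \<and> (\<lambda>n. variation n z \<xi>' / real n) \<longlonglongrightarrow> \<tau>"
  then show "(\<lambda>n. variation n z \<xi> / real n) \<longlonglongrightarrow> \<tau>"
    using torsion_direction_independent [OF _ assms] by blast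
qed (use assms in blast)

text \<open>Valid also where no limit exists, as both sides are definite descriptions of the same
  predicate. Thus \<open>torsion F\<close> is Borel on the whole torus, not just almost
  everywhere.\<close>

lemma torsion_eq_lim: "\<xi> \<noteq> 0 \<Longrightarrow> torsion F z = lim (\<lambda>n. variation n z \<xi> / real n)"
proof -
  assume "\<xi> \<noteq> 0"
  then have "has_torsion F z = (\<lambda>\<tau>. (\<lambda>n. variation n z \<xi> / real n) \<longlonglongrightarrow> \<tau>)"
    by (intro ext has_torsion_iff)
  then show ?thesis by (simp only: torsion_def lim_def)
qed

lemma borel_measurable_variation: "(\<lambda>z. variation n z (1, 0)) \<in> borel_measurable borel"
proof -
  have "continuous_on UNIV (\<lambda>z. cocycle n (z, abs_circle 0))"
    by (rule continuous_on_compose2 [OF continuous_on_cocycle]) (auto intro!: continuous_intros)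
  from borel_measurable_continuous_onI [OF this] show ?thesis by (simp add: cocycle_horizontal)
qed

lemma null_torsion_measure:
  "\<exists>\<mu>. invariant_borel_prob f \<mu> \<and> (AE z in \<mu>. \<exists>\<tau>. has_torsion F z \<tau>) \<and>
    integrable \<mu> (torsion F) \<and> measure_torsion F \<mu> = 0"
proof -
  have nz: "(1, 0) \<noteq> (0 :: real \<times> real)" by (simp add: zero_prod_def)
  have "\<forall>n. \<exists>z. \<bar>variation n z (1, 0)\<bar> \<le> pi" using small_variation by blast
  then obtain z where z: "\<And>n. \<bar>variation n (z n) (1, 0)\<bar> \<le> pi" by metis
  obtain \<phi> :: "real \<Rightarrow> torus \<times> circle" where \<phi>: "continuous_on UNIV \<phi>" "\<phi> ` {0..1} = UNIV"
    by (rule space_filling_curve)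
  obtain N r where N: "prob_space N" "sets N = sets borel" "strict_mono r" "distr N borel skew = N"
    and lim: "\<And>h :: torus \<times> circle \<Rightarrow> real. continuous_on UNIV h \<Longrightarrow>
      (\<lambda>n. (\<Sum>k<r n. h ((skew ^^ k) (z (r n), abs_circle 0))) / real (r n)) \<longlonglongrightarrow> (\<integral>y. h y \<partial>N)"
    using krylov_bogolyubov [OF \<phi> continuous_on_skew, of "\<lambda>n. (z n, abs_circle 0)"] by blast
  have [measurable_cong]: "sets N = sets borel" by (rule N)
  have "compact (cocycle 1 ` \<phi> ` {0..1})"
    by (intro compact_continuous_image compact_Icc continuous_on_subset [OF continuous_on_cocycle]
        continuous_on_subset [OF \<phi>(1)]) auto
  then obtain B where B: "\<And>p. \<bar>cocycle 1 p\<bar> \<le> B"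
    unfolding \<phi>(2) using compact_imp_bounded bounded_iff by (metis rangeI real_norm_def)
  interpret N: prob_space N by (rule N)
  have meas_of_cont: "h \<in> borel_measurable N" if "continuous_on UNIV h" for h :: "torus \<times> circle \<Rightarrow> 'c::topological_space"
    using borel_measurable_continuous_onI [OF that] measurable_cong_sets [OF N(2) refl] by blast
  interpret measure_preserving N skew
  proof
    show "skew \<in> measurable N N"
      using meas_of_cont [OF continuous_on_skew] measurable_cong_sets [OF refl N(2)] by blast
    show "distr N N skew = N" using N(4) distr_cong [OF refl N(2)] by metis
  qed
  have cocycle: "birkhoff_sum (cocycle 1) n = cocycle n" for n
    by (simp only: fun_eq_iff birkhoff_sum_def cocycle_sum [of n] simp_thms)
  have meas1: "cocycle 1 \<in> borel_measurable N" by (rule meas_of_cont [OF continuous_on_cocycle])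
  \<comment> \<open>The average of \<open>cocycle 1\<close> over the segment is the total variation
    divided by its length, and the start points were chosen with total variation at most
    \<pi>.\<close>
  have "(\<lambda>n. cocycle (r n) (z (r n), abs_circle 0) / real (r n)) \<longlonglongrightarrow> 0"
  proof (rule Lim_null_comparison)
    show "\<forall>\<^sub>F n in sequentially. norm (cocycle (r n) (z (r n), abs_circle 0) / real (r n)) \<le> pi / real (r n)"
      using z by (intro always_eventually allI) (simp add: cocycle_horizontal divide_right_mono)
    show "(\<lambda>n. pi / real (r n)) \<longlonglongrightarrow> 0"
      by (rule filterlim_compose [OF lim_const_over_n filterlim_subseq [OF N(3)]])
  qed
  moreover have "(\<lambda>n. cocycle (r n) (z (r n), abs_circle 0) / real (r n)) \<longlonglongrightarrow> (\<integral>p. cocycle 1 p \<partial>N)"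
    using lim [OF continuous_on_cocycle [of 1]] by (simp only: cocycle_sum [symmetric])
  ultimately have integral_0: "(\<integral>p. cocycle 1 p \<partial>N) = 0" by (rule LIMSEQ_unique [symmetric])
  have conv: "AE p in N. convergent (\<lambda>n. cocycle n p / real n)"
    using birkhoff_convergent [OF meas1 B] by (simp only: cocycle)
  have fst_meas: "fst \<in> borel_measurable N" by (intro meas_of_cont continuous_intros)
  define \<mu> where "\<mu> = distr N borel fst"
  have f_cont: "continuous_on UNIV f"
    using continuous_on_E [of UNIV "\<lambda>_. 1" "\<lambda>z. z"] E_nat [of 1] by simp
  have "invariant_borel_prob f \<mu>"
    unfolding invariant_borel_prob_def
  proof (intro conjI)
    show "prob_space \<mu>" unfolding \<mu>_def by (rule N.prob_space_distr [OF fst_meas])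
    show "sets \<mu> = sets borel" by (simp add: \<mu>_def)
    show f_meas: "f \<in> borel_measurable borel" by (rule borel_measurable_continuous_onI [OF f_cont])
    have "distr \<mu> borel f = distr N borel (f \<circ> fst)"
      unfolding \<mu>_def by (rule distr_distr [OF f_meas fst_meas])
    also have "f \<circ> fst = fst \<circ> skew" by (auto simp: skew_def)
    also have "distr N borel (fst \<circ> skew) = distr (distr N N skew) borel fst"
      by (rule distr_distr [OF fst_meas G_measurable, symmetric])
    finally show "distr \<mu> borel f = \<mu>" by (simp only: distr_G \<mu>_def)
  qed
  moreover have ae: "AE w in \<mu>. convergent (\<lambda>n. variation n w (1, 0) / real n)"
  proof -
    \<comment> \<open>Moving an almost everywhere statement through \<open>distr\<close> requires a
      measurable set, for which the Cauchy criterion is the convenient form of convergence.\<close>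
    have "{w \<in> space borel. Cauchy (\<lambda>n. variation n w (1, 0) / real n)} \<in> sets borel"
      by (intro sets_Collect_Cauchy borel_measurable_divide borel_measurable_variation) simp
    moreover have "AE p in N. convergent (\<lambda>n. variation n (fst p) (1, 0) / real n)"
      using conv
    proof (rule AE_mp, intro AE_I2 impI)
      fix p assume "convergent (\<lambda>n. cocycle n p / real n)"
      then obtain \<tau> where "(\<lambda>n. variation n (fst p) (dirvec_circle (snd p)) / real n) \<longlonglongrightarrow> \<tau>"
        unfolding cocycle_def convergent_def by blast
      then have "(\<lambda>n. variation n (fst p) (1, 0) / real n) \<longlonglongrightarrow> \<tau>"
        by (rule torsion_direction_independent [OF dirvec_circle_nonzero nz])
      then show "convergent (\<lambda>n. variation n (fst p) (1, 0) / real n)" by (rule convergentI)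
    qed
    ultimately show ?thesis
      unfolding \<mu>_def Cauchy_convergent_iff by (subst AE_distr_iff [OF fst_meas])
  qed
  have torsion_meas: "torsion F \<in> borel_measurable borel"
  proof -
    have "(\<lambda>w. lim (\<lambda>n. variation n w (1, 0) / real n)) \<in> borel_measurable borel"
      by (intro borel_measurable_lim_metric borel_measurable_divide borel_measurable_variation) simp
    moreover have "torsion F = (\<lambda>w. lim (\<lambda>n. variation n w (1, 0) / real n))"
      by (rule ext) (rule torsion_eq_lim [OF nz])
    ultimately show ?thesis by simp
  qed
  moreover have "AE w in \<mu>. \<exists>\<tau>. has_torsion F w \<tau>"
    using ae by (simp only: has_torsion_iff [OF nz] convergent_def)
  moreover have "integrable \<mu> (torsion F)"
  proof -
    interpret \<mu>: prob_space \<mu> unfolding \<mu>_def by (rule N.prob_space_distr [OF fst_meas])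
    have bound: "\<bar>variation n w (1, 0) / real n\<bar> \<le> B" for n w
      using birkhoff_average_bounded [where h = "cocycle 1" and x = "(w, abs_circle 0)", OF B, of n]
      by (simp only: cocycle cocycle_horizontal)
    show ?thesis
    proof (rule \<mu>.integrable_const_bound)
      show "AE w in \<mu>. norm (torsion F w) \<le> B"
        using ae
      proof (rule AE_mp, intro AE_I2 impI)
        fix w assume "convergent (\<lambda>n. variation n w (1, 0) / real n)"
        then have "(\<lambda>n. \<bar>variation n w (1, 0) / real n\<bar>) \<longlonglongrightarrow> \<bar>torsion F w\<bar>"
          unfolding convergent_LIMSEQ_iff torsion_eq_lim [OF nz] by (rule tendsto_rabs)
        then show "norm (torsion F w) \<le> B"
          unfolding real_norm_def by (rule LIMSEQ_le_const2) (use bound in blast)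
      qed
      show "torsion F \<in> borel_measurable \<mu>" using torsion_meas by (simp add: \<mu>_def)
    qed
  qed
  moreover have "measure_torsion F \<mu> = 0"
  proof -
    have "measure_torsion F \<mu> = (\<integral>p. torsion F (fst p) \<partial>N)"
      unfolding measure_torsion_def \<mu>_def by (rule integral_distr [OF fst_meas torsion_meas])
    \<comment> \<open>Upstairs the torsion at \<open>fst p\<close> may be computed in the direction
      \<open>snd p\<close> instead of the horizontal one, which turns it into a Birkhoff limit of
      \<open>cocycle 1\<close>.\<close>
    also have "\<dots> = (\<integral>p. lim (\<lambda>n. birkhoff_sum (cocycle 1) n p / real n) \<partial>N)"
      by (rule Bochner_Integration.integral_cong [OF refl])
         (simp only: cocycle cocycle_def torsion_eq_lim [OF dirvec_circle_nonzero])
    also have "\<dots> = 0"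
      using birkhoff_integral [OF meas1 B] integral_0 by simp
    finally show ?thesis .
  qed
  ultimately show ?thesis by blast
qed

end

theorem corollary3p4:
  fixes F :: "real \<Rightarrow> torus \<Rightarrow> torus" and f :: "torus \<Rightarrow> torus"
  assumes "isotopy_from_id F f"
  shows "\<exists>\<mu> :: torus measure.
    invariant_borel_prob f \<mu> \<and>
    (AE z in \<mu>. \<exists>\<tau>. has_torsion F z \<tau>) \<and>
    integrable \<mu> (torsion F) \<and>
    measure_torsion F \<mu> = 0"
proof -
  interpret torus_isotopy F f using assms by unfold_locales
  show ?thesis by (rule null_torsion_measure)
qed

end
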